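(* Let $q\in(0,2]$. Assume the measurement model and the noise-to-signal assumption described in the context. Let $\hat t$ be any function of $y_1,\dots,y_{n_q}$ such that $\hat t\,\gamma_q\|x\|_q\to c_0$ in probability as $(n_q,p)\to\infty$, for some constant $c_0>0$ with $\varphi_0(\bar\rho_q c_0)\neq0$. Then $$\sqrt{n_q}\Big(\frac{\hat\nu_q(\hat t)}{\|x\|_q^q}-1\Big)\xrightarrow{\ w\ } N\big(0,v_q(c_0,\bar\rho_q)\big)$$ as $(n_q,p)\to\infty$, where the limiting variance is strictly positive and given by $$v_q(c_0,\bar\rho_q)=\frac{1}{|c_0|^{2q}}\Big(\frac12\frac{1}{\varphi_0(\bar\rho_q|c_0|)^2}\exp(2|c_0|^q)+\frac12\frac{\varphi_0(2\bar\rho_q|c_0|)}{\varphi_0(\bar\rho_q|c_0|)^2}\exp((2-2^q)|c_0|^q)-1\Big).$$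
   Context: For $q\in(0,2]$ and $\gamma>0$, $\mathrm{stable}_q(\gamma)$ is the symmetric $q$-stable law on $\mathbb{R}$ with characteristic function $t\mapsto\exp(-|\gamma t|^q)$, and $\mathrm{stable}_q(\gamma)^{\otimes p}$ is the law of a vector in $\mathbb{R}^p$ with i.i.d. $\mathrm{stable}_q(\gamma)$ coordinates. Measurement model: $y_i=\langle a_i,x\rangle+\sigma\epsilon_i$, $i=1,\dots,n_q$, where $x\in\mathbb{R}^p\setminus\{0\}$, $\sigma>0$, $a_1,\dots,a_{n_q}$ are i.i.d. $\mathrm{stable}_q(\gamma_q)^{\otimes p}$ with $\gamma_q>0$, and $\epsilon_1,\dots,\epsilon_{n_q}$ are i.i.d. from a distribution $F_0$ that is symmetric about $0$, satisfies $0<\mathbb{E}|\epsilon_1|<\infty$ (possibly infinite variance), and whose characteristic function $\varphi_0$ (real-valued) has isolated zeros (no limit points); the sets $\{a_i\}$ and $\{\epsilon_i\}$ are independent. The quantities $\sigma,\gamma_q,F_0$ are known. Asymptotics: $n_q$ and $p$ tend to infinity along an implicit index; $x,\sigma,\gamma_q,a_i$ may vary with the index, while $F_0$ is fixed; $p/n_q$ is unrestricted. Let $\rho_q:=\sigma/(\gamma_q\|x\|_q)$ and assume (A3) there is a constant $\bar\rho_q\ge0$ with $\rho_q=\bar\rho_q+o(n_q^{-1/2})$. Define $\hat\Psi(t):=\frac1{n_q}\sum_{i=1}^{n_q}e^{\sqrt{-1}ty_i}$, $\mathrm{Log}_+(r):=\log|r|$ for real $r\ne0$ and $\mathrm{Log}_+(0):=1$,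 and for $t\ne0$ with $\varphi_0(\sigma t)\ne0$, $$\hat\nu_q(t):=\frac{-1}{\gamma_q^q|t|^q}\mathrm{Log}_+\,\mathrm{Re}\Big(\frac{\hat\Psi(t)}{\varphi_0(\sigma t)}\Big),$$ with $\hat\nu_q(t):=1$ if $t=0$ or $\varphi_0(\sigma t)=0$. *)

theory Defs
  imports "HOL-Probability.Probability"
begin

text \<open>Symmetric q-stable law with scale gamma: a probability law on the reals
  (Borel sets) whose characteristic function is t \<mapsto> exp(-|gamma t|^q).
  The characteristic function determines the law.\<close>
definition stable_law :: "real \<Rightarrow> real \<Rightarrow> real measure \<Rightarrow> bool" where
  "stable_law q \<gamma> \<mu> \<longleftrightarrow> real_distribution \<mu> \<and>
     (\<forall>t. char \<mu> t = complex_of_real (exp (- (\<bar>\<gamma> * t\<bar> powr q))))"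

definition lq_norm :: "real \<Rightarrow> nat \<Rightarrow> (nat \<Rightarrow> real) \<Rightarrow> real" where
  "lq_norm q p x = (\<Sum>j<p. \<bar>x j\<bar> powr q) powr (1 / q)"

definition Log_plus :: "real \<Rightarrow> real" where
  "Log_plus r = (if r = 0 then 1 else ln \<bar>r\<bar>)"

definition Psi_hat :: "nat \<Rightarrow> (nat \<Rightarrow> real) \<Rightarrow> real \<Rightarrow> complex" where
  "Psi_hat n y t = (1 / of_nat n) * (\<Sum>i<n. cis (t * y i))"

text \<open>The estimator nu_hat_q(t); phi0 is the (real-valued) characteristic
  function of the noise, sigma the noise level, gamma = gamma_q.\<close>
definition nu_hat :: "real \<Rightarrow> (real \<Rightarrow> real) \<Rightarrow> real \<Rightarrow> real \<Rightarrow> nat \<Rightarrow> (nat \<Rightarrow> real) \<Rightarrow> real \<Rightarrow> real" where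
  "nu_hat q \<phi>0 \<sigma> \<gamma> n y t =
     (if t = 0 \<or> \<phi>0 (\<sigma> * t) = 0 then 1
      else - 1 / (\<gamma> powr q * \<bar>t\<bar> powr q) *
           Log_plus (Re (Psi_hat n y t / complex_of_real (\<phi>0 (\<sigma> * t)))))"

definition v_q :: "real \<Rightarrow> (real \<Rightarrow> real) \<Rightarrow> real \<Rightarrow> real \<Rightarrow> real" where
  "v_q q \<phi>0 c0 \<rho> =
     1 / \<bar>c0\<bar> powr (2 * q) *
       (1/2 * (1 / (\<phi>0 (\<rho> * \<bar>c0\<bar>))\<^sup>2) * exp (2 * \<bar>c0\<bar> powr q)
        + 1/2 * (\<phi>0 (2 * \<rho> * \<bar>c0\<bar>) / (\<phi>0 (\<rho> * \<bar>c0\<bar>))\<^sup>2) * exp ((2 - 2 powr q) * \<bar>c0\<bar> powr q)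
        - 1)"

text \<open>Centered normal law with variance v (normal_density takes the standard deviation).\<close>
definition normal_law :: "real \<Rightarrow> real measure" where
  "normal_law v = density lborel (normal_density 0 (sqrt v))"

end

theory Submission
  imports Defs
begin

text \<open>After rescaling by the norm of \<open>x\<close> times the scale, the observations \<open>Z i\<close> are i.i.d. with
  \<open>E cos (s Z) = m s = exp (- |s|^q) \<phi>0 (\<rho> s)\<close>, and the estimation error at \<open>s\<close> is
  \<open>- sqrt n |s|^(-q) ln (1 + G s / (sqrt n m s))\<close>, where \<open>G\<close> is the empirical process of the functions
  \<open>cos (s Z)\<close>. Only cosine moments are needed: \<open>1 - m h \<le> K |h|^min(q,1)\<close> bounds the variance
  of the increments of \<open>G\<close>, so that dyadic chaining gives stochastic equicontinuity near \<open>c0\<close>. This allows one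
  to replace the random point by \<open>c0\<close>, where \<open>G c0\<close> is asymptotically normal; linearizing the logarithm and
  Levy's continuity theorem finish the proof.\<close>

section \<open>The empirical cosine process\<close>

text \<open>The estimated frequency is computed from the same observations, so a central limit
  theorem at a fixed point does not apply to it. A bound on \<open>G\<close> valid for all points
  near \<open>c0\<close> at once removes this dependence. It cannot come from differentiating
  \<open>G\<close>: for \<open>q \<le> 1\<close> the rescaled observations have no mean. What
  remains is the exponent \<open>min q 1\<close>: the stable factor of \<open>m\<close> contributes
  \<open>|h|^q\<close>, and the noise, which has a first moment, contributes \<open>|h|\<close>. No
  bias arises at the random point. The estimator divides by the noise factor at the frequency
  actually used, so its logarithm is centred exactly at \<open>- |s|^q\<close>, and consistency of
  the frequency is enough without a rate. The law of the data changes with the index, so the data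
  form a triangular array. The probability bounds are therefore explicit and uniform over all rows
  with the same \<open>K\<close> and \<open>\<alpha>\<close>. Rescaling by
  \<open>\<gamma> ||x||_q\<close> is what lets one such pair serve all late rows.\<close>

lemma cos_diff_squared_le: "(cos a - cos b)\<^sup>2 \<le> 2 * (1 - cos (a - b))" for a b :: real
proof -
  \<comment> \<open>Squared chord between two points of the unit circle; the sine part is then
    dropped.\<close>
  have "2 * (1 - cos (a - b)) = (cos a - cos b)\<^sup>2 + (sin a - sin b)\<^sup>2"
    using sin_cos_squared_add[of a] sin_cos_squared_add[of b]
    by (simp add: cos_diff power2_eq_square algebra_simps)
  then show ?thesis by simp
qed

text \<open>Turns a bounded centred summand into a moment bound by its variance. For negative
  \<open>u\<close> the factorization of \<open>1 + w ^ 3\<close> reduces the claim to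
  \<open>1 + w \<le> exp w\<close>.\<close>

lemma exp_le_one_plus_square:
  fixes u :: real
  assumes "\<bar>u\<bar> \<le> 1"
  shows "exp u \<le> 1 + u + u\<^sup>2"
proof (cases "0 \<le> u")
  case True
  then show ?thesis using exp_bound[of u] assms by simp
next
  case False
  define w where "w = - u"
  have w: "0 \<le> w" "w \<le> 1" using False assms by (auto simp: w_def)
  have "1 \<le> (1 - w + w\<^sup>2) * (1 + w)"
  proof -
    have "(1 - w + w\<^sup>2) * (1 + w) = 1 + w ^ 3" by (simp add: algebra_simps power2_eq_square power3_eq_cube)
    then show ?thesis using w by simp
  qed
  also have "\<dots> \<le> (1 - w + w\<^sup>2) * exp w"
    using w exp_ge_add_one_self[of w] by (intro mult_left_mono) auto
  finally have "exp (- w) \<le> 1 - w + w\<^sup>2"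
    by (simp add: exp_minus field_simps)
  then show ?thesis by (simp add: w_def)
qed

text \<open>With \<open>exp (- w) \<le> 1 / (1 + w)\<close> the right side is at least
  \<open>6 u^2 / (2 + u^2)\<close>. The factor 6 is the one for which this equals 4 at
  \<open>|u| = 2\<close>, where the truncation sets in.\<close>

lemma min_2_squared_le:
  fixes u :: real
  shows "(min 2 \<bar>u\<bar>)\<^sup>2 \<le> 6 * (1 - exp (- u\<^sup>2 / 2))"
proof -
  have "1 + u\<^sup>2 / 2 \<le> exp (u\<^sup>2 / 2)" by (rule exp_ge_add_one_self)
  then have "exp (- u\<^sup>2 / 2) \<le> 1 / (1 + u\<^sup>2 / 2)"
    by (simp add: exp_minus divide_simps add_pos_nonneg)
  then have "6 * (1 - 1 / (1 + u\<^sup>2 / 2)) \<le> 6 * (1 - exp (- u\<^sup>2 / 2))" by simp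
  moreover have "(min 2 \<bar>u\<bar>)\<^sup>2 \<le> 6 * (1 - 1 / (1 + u\<^sup>2 / 2))"
  proof (cases "\<bar>u\<bar> \<le> 2")
    case True
    then have le: "u\<^sup>2 \<le> 4" using abs_le_square_iff[of u 2] by simp
    have "u\<^sup>2 * (2 + u\<^sup>2) \<le> u\<^sup>2 * 6" using le by (intro mult_left_mono) auto
    moreover have "(min 2 \<bar>u\<bar>)\<^sup>2 = u\<^sup>2" using True by (simp add: min_def)
    moreover have "2 + u\<^sup>2 > 0" by (simp add: add_pos_nonneg)
    ultimately show ?thesis by (simp add: field_simps)
  next
    case False
    then have le: "4 \<le> u\<^sup>2" using abs_le_square_iff[of 2 u] by simp
    then show ?thesis using False by (simp add: min_def field_simps)
  qed
  ultimately show ?thesis by linarith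
qed

lemma integral_cos_std_normal:
  "(\<integral>x. cos (a * x) \<partial>std_normal_distribution) = exp (- a\<^sup>2 / 2)"
proof -
  interpret N: real_distribution std_normal_distribution by (rule real_dist_normal_dist)
  have "Re (char std_normal_distribution a) = (\<integral>x. Re (iexp (a * x)) \<partial>std_normal_distribution)"
    unfolding char_def by (intro integral_Re[symmetric] N.integrable_iexp) auto
  also have "\<dots> = (\<integral>x. cos (a * x) \<partial>std_normal_distribution)"
    by (simp add: Re_exp)
  finally show ?thesis by (simp add: char_std_normal_distribution)
qed

text \<open>One row of the triangular array. The law of \<open>Z\<close> enters only through
  independence and cosine moments. \<open>K\<close> and \<open>\<alpha>\<close> are parameters, so
  that a statement can fix them before quantifying over samples.\<close>

locale cosine_sample = prob_space +
  fixes n :: nat and Z :: "nat \<Rightarrow> 'a \<Rightarrow> real" and m :: "real \<Rightarrow> real" and K \<alpha> :: real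
  assumes n_pos: "0 < n"
    and indep_Z: "indep_vars (\<lambda>_. borel) Z {..<n}"
    and expectation_cos_Z: "\<And>i t. i < n \<Longrightarrow> expectation (\<lambda>\<omega>. cos (t * Z i \<omega>)) = m t"
    and \<alpha>_pos: "0 < \<alpha>" and \<alpha>_le_1: "\<alpha> \<le> 1"
    and one_minus_m_le: "\<And>h. 1 - m h \<le> K * \<bar>h\<bar> powr \<alpha>"
begin

definition X :: "real \<Rightarrow> nat \<Rightarrow> 'a \<Rightarrow> real" where
  "X t i \<omega> = cos (t * Z i \<omega>) - m t"

definition G :: "real \<Rightarrow> 'a \<Rightarrow> real" where
  "G t \<omega> = (\<Sum>i<n. X t i \<omega>) / sqrt n"

section \<open>Measurability and first two moments of the summands\<close>

lemma Z_measurable[measurable]: "i < n \<Longrightarrow> Z i \<in> borel_measurable M"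
  using indep_Z by (auto simp: indep_vars_def2)

lemma X_measurable[measurable]: "i < n \<Longrightarrow> X t i \<in> borel_measurable M"
  unfolding X_def by measurable

lemma G_measurable[measurable]: "G t \<in> borel_measurable M"
  unfolding G_def by measurable

lemma integrable_cos_Z: "i < n \<Longrightarrow> integrable M (\<lambda>\<omega>. cos (t * Z i \<omega>))"
  by (intro integrable_const_bound[of _ 1]) auto

lemma m_le_1: "m t \<le> 1" and m_ge: "- 1 \<le> m t"
proof -
  have "m t = expectation (\<lambda>\<omega>. cos (t * Z 0 \<omega>))" using expectation_cos_Z n_pos by simp
  moreover have "expectation (\<lambda>\<omega>. cos (t * Z 0 \<omega>)) \<le> 1"
    using n_pos by (intro integral_le_const integrable_cos_Z) auto
  moreover have "- 1 \<le> expectation (\<lambda>\<omega>. cos (t * Z 0 \<omega>))"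
    using n_pos by (intro integral_ge_const integrable_cos_Z) auto
  ultimately show "m t \<le> 1" "- 1 \<le> m t" by auto
qed

lemma K_nonneg: "0 \<le> K"
  using one_minus_m_le[of 1] m_le_1[of 1] by simp

lemma abs_X_le: "\<bar>X t i \<omega>\<bar> \<le> 2"
  unfolding X_def using m_le_1[of t] m_ge[of t] cos_le_one[of "t * Z i \<omega>"] cos_ge_minus_one[of "t * Z i \<omega>"]
  by linarith

lemma integrable_X: "i < n \<Longrightarrow> integrable M (X t i)"
  by (intro integrable_const_bound[of _ 2]) (auto simp: abs_X_le)

lemma expectation_X: "i < n \<Longrightarrow> expectation (X t i) = 0"
  unfolding X_def using integrable_cos_Z expectation_cos_Z by (simp add: prob_space)

text \<open>The double angle formula expresses the second moment through \<open>m\<close> again;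
  this is the origin of the term with \<open>2 * \<rho>\<close> in the limiting variance.\<close>

lemma expectation_X_square:
  assumes "i < n"
  shows "expectation (\<lambda>\<omega>. (X t i \<omega>)\<^sup>2) = (1 + m (2 * t)) / 2 - (m t)\<^sup>2"
proof -
  have eq: "(X t i \<omega>)\<^sup>2 = 1 / 2 + cos ((2 * t) * Z i \<omega>) / 2 - 2 * m t * cos (t * Z i \<omega>) + (m t)\<^sup>2" for \<omega>
    using cos_double_cos[of "t * Z i \<omega>"]
    by (simp add: X_def power2_diff mult.assoc diff_divide_distrib)
  show ?thesis
  proof -
    have "expectation (\<lambda>\<omega>. (X t i \<omega>)\<^sup>2) = 1 / 2 + m (2 * t) / 2 - 2 * m t * m t + (m t)\<^sup>2"
      unfolding eq using integrable_cos_Z[OF assms] expectation_cos_Z[OF assms] by (simp add: prob_space)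
    then show ?thesis by (simp add: power2_eq_square add_divide_distrib)
  qed
qed

lemma variance_bounds: "0 \<le> (1 + m (2 * t)) / 2 - (m t)\<^sup>2" "(1 + m (2 * t)) / 2 - (m t)\<^sup>2 \<le> 1"
proof -
  have "0 \<le> expectation (\<lambda>\<omega>. (X t 0 \<omega>)\<^sup>2)" by simp
  then show "0 \<le> (1 + m (2 * t)) / 2 - (m t)\<^sup>2" using expectation_X_square[of 0 t] n_pos by simp
  have "(1 + m (2 * t)) / 2 - (m t)\<^sup>2 \<le> (1 + m (2 * t)) / 2 - 0" by (intro diff_mono) auto
  also have "\<dots> \<le> 1" using m_le_1[of "2 * t"] by simp
  finally show "(1 + m (2 * t)) / 2 - (m t)\<^sup>2 \<le> 1" .
qed

text \<open>A central limit theorem with explicit error, uniform over the laws of \<open>Z\<close>.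
  The \<open>n\<close> factors are compared one by one with equal Gaussian factors. Each costs
  \<open>4/3 |w|^3\<close> for \<open>w = u / sqrt n\<close>, because \<open>|X| \<le> 2\<close>
  gives \<open>8 / 6\<close>, plus the Taylor error of the Gaussian factor, where the variance is at
  most 1.\<close>

lemma char_G_bound:
  defines "v t \<equiv> (1 + m (2 * t)) / 2 - (m t)\<^sup>2"
  shows "cmod (char (distr M borel (G t)) u - complex_of_real (exp (- u\<^sup>2 * v t / 2)))
     \<le> 4 / 3 * \<bar>u\<bar> ^ 3 / sqrt n + u ^ 4 / (8 * n)"
proof -
  let ?w = "u / sqrt n"
  let ?z = "\<lambda>i. char (distr M borel (X t i)) ?w"
  let ?e = "exp (- u\<^sup>2 * v t / (2 * n))"
  have v: "0 \<le> v t" "v t \<le> 1" using variance_bounds[of t] by (auto simp: v_def)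
  have n0: "0 < real n" using n_pos by simp
  have indepX: "indep_vars (\<lambda>_. borel) (\<lambda>i \<omega>. X t i \<omega> / sqrt n) {..<n}"
    unfolding X_def by (rule indep_vars_compose2[OF indep_Z]) auto
  have "char (distr M borel (G t)) u = char (distr M borel (\<lambda>\<omega>. \<Sum>i<n. X t i \<omega> / sqrt n)) u"
    unfolding G_def by (simp add: sum_divide_distrib)
  also have "\<dots> = (\<Prod>i<n. char (distr M borel (\<lambda>\<omega>. X t i \<omega> / sqrt n)) u)"
    by (rule char_distr_sum[OF indepX])
  also have "\<dots> = (\<Prod>i<n. ?z i)"
    by (intro prod.cong) (auto simp: char_def integral_distr)
  finally have 1: "char (distr M borel (G t)) u = (\<Prod>i<n. ?z i)" .
  have "(\<Prod>i<n. complex_of_real ?e) = complex_of_real (exp (real n * (- u\<^sup>2 * v t / (2 * n))))"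
    by (simp only: exp_of_nat_mult of_real_power prod_constant card_lessThan)
  also have "real n * (- u\<^sup>2 * v t / (2 * n)) = - u\<^sup>2 * v t / 2" using n0 by simp
  finally have 2: "complex_of_real (exp (- u\<^sup>2 * v t / 2)) = (\<Prod>i<n. complex_of_real ?e)" by simp
  have each: "cmod (?z i - complex_of_real ?e) \<le> (4 / 3 * \<bar>u\<bar> ^ 3 / sqrt n + u ^ 4 / (8 * n)) / n" if i: "i < n" for i
  proof -
    have wn: "?w\<^sup>2 = u\<^sup>2 / n" by (simp add: power_divide)
    have sq: "integrable M (\<lambda>\<omega>. (X t i \<omega>)\<^sup>2)"
      using i abs_X_le power_mono[OF abs_X_le, of t i _ 2] by (intro integrable_const_bound[of _ 4]) auto
    have cube: "\<bar>X t i \<omega>\<bar> ^ 3 \<le> 8" for \<omega>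
      using power_mono[OF abs_X_le, of t i \<omega> 3] by simp
    have "cmod (?z i - (1 - ?w\<^sup>2 * v t / 2)) \<le>
        (?w\<^sup>2 / 6) * expectation (\<lambda>\<omega>. min (6 * (X t i \<omega>)\<^sup>2) (\<bar>?w\<bar> * \<bar>X t i \<omega>\<bar> ^ 3))"
      using i expectation_X_square[OF i, of t] integrable_X[OF i] sq expectation_X[OF i]
      by (intro char_approx3') (auto simp: v_def)
    also have "\<dots> \<le> (?w\<^sup>2 / 6) * (\<bar>?w\<bar> * 8)"
    proof (intro mult_left_mono integral_le_const)
      show "integrable M (\<lambda>\<omega>. min (6 * (X t i \<omega>)\<^sup>2) (\<bar>?w\<bar> * \<bar>X t i \<omega>\<bar> ^ 3))"
        using sq i by (intro Bochner_Integration.integrable_bound[OF integrable_mult_right[OF sq, of 6]]) auto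
      show "AE \<omega> in M. min (6 * (X t i \<omega>)\<^sup>2) (\<bar>?w\<bar> * \<bar>X t i \<omega>\<bar> ^ 3) \<le> \<bar>?w\<bar> * 8"
        using cube by (intro AE_I2 min.coboundedI2 mult_left_mono) auto
    qed auto
    also have "\<dots> = (4 / 3 * \<bar>u\<bar> ^ 3 / sqrt n) / n"
      by (simp add: wn power3_eq_cube abs_mult power2_eq_square mult_ac)
    finally have a: "cmod (?z i - (1 - ?w\<^sup>2 * v t / 2)) \<le> (4 / 3 * \<bar>u\<bar> ^ 3 / sqrt n) / n" .
    \<comment> \<open>The Gaussian factor is compared with the same quadratic polynomial
      \<open>1 - y\<close> as the characteristic function.\<close>
    define y where "y = u\<^sup>2 * v t / (2 * n)"
    have y: "0 \<le> y" using v by (simp add: y_def)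
    have "\<bar>exp (-y) - (1 - y)\<bar> \<le> y\<^sup>2 / 2"
    proof -
      have l: "1 - y \<le> exp (-y)" using exp_ge_add_one_self[of "-y"] by simp
      have "exp (-y) \<le> 1 - y + y\<^sup>2 / 2"
      proof -
        let ?f = "\<lambda>y::real. 1 - y + y\<^sup>2 / 2 - exp (-y)"
        have "?f 0 \<le> ?f y"
        proof (rule DERIV_nonneg_imp_nondecreasing[OF y])
          fix x :: real assume "0 \<le> x"
          show "\<exists>z. (?f has_real_derivative z) (at x) \<and> 0 \<le> z"
            using exp_ge_add_one_self[of "-x"]
            by (intro exI[of _ "-1 + x + exp (-x)"]) (auto intro!: derivative_eq_intros)
        qed
        then show ?thesis by simp
      qed
      with l show ?thesis by simp
    qed
    moreover have "y\<^sup>2 / 2 \<le> (u ^ 4 / (8 * n)) / n"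
    proof -
      have "(v t)\<^sup>2 \<le> 1" using v by (simp add: power_le_one)
      then have "u ^ 4 * (v t)\<^sup>2 \<le> u ^ 4 * 1" by (intro mult_left_mono) auto
      moreover have "y\<^sup>2 / 2 = u ^ 4 * (v t)\<^sup>2 / (8 * n * n)"
        by (simp add: y_def power_divide power_mult_distrib power2_eq_square eval_nat_numeral mult_ac)
      ultimately show ?thesis using n0 by (simp add: divide_right_mono mult.assoc)
    qed
    moreover have "?e = exp (-y)" "1 - ?w\<^sup>2 * v t / 2 = 1 - y" by (simp_all add: y_def wn)
    ultimately have b: "\<bar>?e - (1 - ?w\<^sup>2 * v t / 2)\<bar> \<le> (u ^ 4 / (8 * n)) / n" by linarith
    have "cmod (?z i - complex_of_real ?e) \<le> cmod (?z i - complex_of_real (1 - ?w\<^sup>2 * v t / 2))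
        + cmod (complex_of_real (1 - ?w\<^sup>2 * v t / 2) - complex_of_real ?e)"
      using dist_triangle[of "?z i" "complex_of_real ?e" "complex_of_real (1 - ?w\<^sup>2 * v t / 2)"] unfolding dist_norm .
    also have "cmod (complex_of_real (1 - ?w\<^sup>2 * v t / 2) - complex_of_real ?e) = \<bar>?e - (1 - ?w\<^sup>2 * v t / 2)\<bar>"
      by (simp only: of_real_diff[symmetric] norm_of_real abs_minus_commute)
    finally show ?thesis using a b by (simp add: add_divide_distrib)
  qed
  \<comment> \<open>Telescoping of the two products; it needs all factors in the unit disc.\<close>
  have "cmod ((\<Prod>i<n. ?z i) - (\<Prod>i<n. complex_of_real ?e)) \<le> (\<Sum>i<n. cmod (?z i - complex_of_real ?e))"
  proof (rule norm_prod_diff)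
    fix i assume "i \<in> {..<n}"
    then interpret D: real_distribution "distr M borel (X t i)" by (intro real_distribution_distr) auto
    show "cmod (?z i) \<le> 1" by (rule D.cmod_char_le_1)
    show "cmod (complex_of_real ?e) \<le> 1" using v by simp
  qed
  also have "\<dots> \<le> (\<Sum>i<n. (4 / 3 * \<bar>u\<bar> ^ 3 / sqrt n + u ^ 4 / (8 * n)) / n)"
    using each by (intro sum_mono) auto
  also have "\<dots> = 4 / 3 * \<bar>u\<bar> ^ 3 / sqrt n + u ^ 4 / (8 * n)" using n0 by simp
  finally show ?thesis unfolding 1 2 .
qed

text \<open>A sub-Gaussian bound on a limited range of \<open>lam\<close>: the summands of the
  increment are bounded by 4, and the assumption keeps every exponent in \<open>[-1, 1]\<close>,
  where the quadratic bound on \<open>exp\<close> holds. The variance is controlled by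
  \<open>2 (1 - m (s - t))\<close>.\<close>

lemma expectation_exp_G_diff:
  assumes "\<bar>lam\<bar> * 4 \<le> sqrt n"
  shows "integrable M (\<lambda>\<omega>. exp (lam * (G s \<omega> - G t \<omega>)))"
    and "expectation (\<lambda>\<omega>. exp (lam * (G s \<omega> - G t \<omega>))) \<le> exp (lam\<^sup>2 * (2 * K * \<bar>s - t\<bar> powr \<alpha>))"
proof -
  let ?D = "\<lambda>i \<omega>. X s i \<omega> - X t i \<omega>"
  let ?c = "lam / sqrt n"
  have n0: "0 < real n" using n_pos by simp
  have D: "\<bar>?D i \<omega>\<bar> \<le> 4" for i \<omega> using abs_X_le[of s i \<omega>] abs_X_le[of t i \<omega>] by linarith
  have cD: "\<bar>?c * ?D i \<omega>\<bar> \<le> 1" for i \<omega>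
  proof -
    have "\<bar>?c * ?D i \<omega>\<bar> \<le> \<bar>?c\<bar> * 4" unfolding abs_mult using D by (intro mult_left_mono) auto
    also have "\<dots> \<le> 1" using assms n0 by simp
    finally show ?thesis .
  qed
  have eq: "exp (lam * (G s \<omega> - G t \<omega>)) = (\<Prod>i<n. exp (?c * ?D i \<omega>))" for \<omega>
    by (simp add: G_def exp_sum[symmetric] sum_subtractf sum_distrib_left[symmetric] sum_divide_distrib[symmetric] diff_divide_distrib[symmetric])
  have int: "integrable M (\<lambda>\<omega>. exp (?c * ?D i \<omega>))" if "i < n" for i
  proof (rule integrable_const_bound[of _ "exp 1"])
    show "AE \<omega> in M. norm (exp (?c * ?D i \<omega>)) \<le> exp 1"
      using cD abs_le_D1 by (intro AE_I2) (simp only: real_norm_def abs_exp_cancel exp_le_cancel_iff, blast)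
  qed (use that in measurable)
  have ind: "indep_vars (\<lambda>_. borel) (\<lambda>i \<omega>. exp (?c * ?D i \<omega>)) {..<n}"
    unfolding X_def by (rule indep_vars_compose2[OF indep_Z]) auto
  show "integrable M (\<lambda>\<omega>. exp (lam * (G s \<omega> - G t \<omega>)))"
    unfolding eq using int by (intro indep_vars_integrable ind) auto
  have each: "expectation (\<lambda>\<omega>. exp (?c * ?D i \<omega>)) \<le> exp (lam\<^sup>2 * (2 * K * \<bar>s - t\<bar> powr \<alpha>) / n)" if i: "i < n" for i
  proof -
    \<comment> \<open>A majorant whose mean is known exactly. Expanding the square around the
      uncentred cosine difference leaves an extra term that is linear in \<open>?D\<close>, hence of
      mean zero.\<close>
    let ?B = "\<lambda>\<omega>. 1 + ?c * ?D i \<omega> + ?c\<^sup>2 * (2 * (1 - cos ((s - t) * Z i \<omega>)) + 2 * (m t - m s) * ?D i \<omega>)"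
    have e0: "exp (?c * ?D i \<omega>) \<le> ?B \<omega>" for \<omega>
    proof -
      have "(cos (s * Z i \<omega>) - cos (t * Z i \<omega>))\<^sup>2 \<le> 2 * (1 - cos ((s - t) * Z i \<omega>))"
        using cos_diff_squared_le[of "s * Z i \<omega>" "t * Z i \<omega>"] by (simp add: algebra_simps)
      moreover have "(?D i \<omega>)\<^sup>2 = (cos (s * Z i \<omega>) - cos (t * Z i \<omega>))\<^sup>2 + 2 * (m t - m s) * ?D i \<omega> - (m t - m s)\<^sup>2"
        unfolding X_def by (simp add: power2_eq_square algebra_simps)
      ultimately have "(?D i \<omega>)\<^sup>2 \<le> 2 * (1 - cos ((s - t) * Z i \<omega>)) + 2 * (m t - m s) * ?D i \<omega>"
        using zero_le_power2[of "m t - m s"] by linarith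
      then have "(?c * ?D i \<omega>)\<^sup>2 \<le> ?c\<^sup>2 * (2 * (1 - cos ((s - t) * Z i \<omega>)) + 2 * (m t - m s) * ?D i \<omega>)"
        unfolding power_mult_distrib by (intro mult_left_mono) auto
      then show ?thesis using exp_le_one_plus_square[OF cD[of i \<omega>]] by linarith
    qed
    have "expectation (\<lambda>\<omega>. exp (?c * ?D i \<omega>)) \<le> expectation ?B"
      using i int integrable_X integrable_cos_Z e0 by (intro integral_mono) auto
    also have "\<dots> = 1 + ?c\<^sup>2 * (2 * (1 - m (s - t)))"
      using i integrable_X[OF i] integrable_cos_Z[OF i] expectation_X[OF i] expectation_cos_Z[OF i]
      by (simp add: prob_space)
    also have "\<dots> \<le> 1 + ?c\<^sup>2 * (2 * (K * \<bar>s - t\<bar> powr \<alpha>))"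
      using one_minus_m_le by (intro add_left_mono mult_left_mono) auto
    also have "\<dots> \<le> exp (?c\<^sup>2 * (2 * (K * \<bar>s - t\<bar> powr \<alpha>)))" by (rule exp_ge_add_one_self)
    finally show ?thesis by (simp add: power_divide mult.assoc)
  qed
  have "expectation (\<lambda>\<omega>. exp (lam * (G s \<omega> - G t \<omega>))) = (\<Prod>i<n. expectation (\<lambda>\<omega>. exp (?c * ?D i \<omega>)))"
    unfolding eq using int by (intro indep_vars_lebesgue_integral ind) auto
  also have "\<dots> \<le> (\<Prod>i<n. exp (lam\<^sup>2 * (2 * K * \<bar>s - t\<bar> powr \<alpha>) / n))"
    using each by (intro prod_mono) (auto intro!: integral_nonneg)
  also have "\<dots> = exp (real n * (lam\<^sup>2 * (2 * K * \<bar>s - t\<bar> powr \<alpha>) / n))"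
    by (simp only: exp_of_nat_mult prod_constant card_lessThan)
  finally show "expectation (\<lambda>\<omega>. exp (lam * (G s \<omega> - G t \<omega>))) \<le> exp (lam\<^sup>2 * (2 * K * \<bar>s - t\<bar> powr \<alpha>))"
    using n0 by simp
qed

text \<open>Chernoff bound for both signs. \<open>lam\<close> is left free because the chaining
  picks it by level rather than by optimization, inside the admissible range.\<close>

lemma G_diff_tail:
  assumes "0 < lam" "4 * lam \<le> sqrt n"
  shows "prob {\<omega> \<in> space M. \<bar>G s \<omega> - G t \<omega>\<bar> > x} \<le> 2 * exp (lam\<^sup>2 * (2 * K * \<bar>s - t\<bar> powr \<alpha>) - lam * x)"
proof -
  let ?v = "lam\<^sup>2 * (2 * K * \<bar>s - t\<bar> powr \<alpha>)"
  have one: "prob {\<omega> \<in> space M. exp (l * (G s \<omega> - G t \<omega>)) \<ge> exp (lam * x)} \<le> exp (?v - lam * x)"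
    if l: "\<bar>l\<bar> = lam" for l
  proof -
    have l4: "\<bar>l\<bar> * 4 \<le> sqrt n" using l assms by simp
    have "prob {\<omega> \<in> space M. exp (l * (G s \<omega> - G t \<omega>)) \<ge> exp (lam * x)}
        \<le> expectation (\<lambda>\<omega>. exp (l * (G s \<omega> - G t \<omega>))) / exp (lam * x)"
      by (rule integral_Markov_inequality_measure[OF expectation_exp_G_diff(1)[OF l4] sets.empty_sets]) auto
    also have "\<dots> \<le> exp (l\<^sup>2 * (2 * K * \<bar>s - t\<bar> powr \<alpha>)) / exp (lam * x)"
      by (intro divide_right_mono expectation_exp_G_diff(2)[OF l4]) auto
    also have "l\<^sup>2 = lam\<^sup>2" using l power2_abs[of l] by simp
    finally show ?thesis by (simp add: exp_diff)
  qed
  have "prob {\<omega> \<in> space M. \<bar>G s \<omega> - G t \<omega>\<bar> > x}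
     \<le> prob ({\<omega> \<in> space M. exp (lam * (G s \<omega> - G t \<omega>)) \<ge> exp (lam * x)} \<union>
             {\<omega> \<in> space M. exp ((- lam) * (G s \<omega> - G t \<omega>)) \<ge> exp (lam * x)})"
  proof (rule finite_measure_mono)
    have "lam * x \<le> lam * (G s \<omega> - G t \<omega>) \<or> lam * x \<le> (- lam) * (G s \<omega> - G t \<omega>)"
      if "\<bar>G s \<omega> - G t \<omega>\<bar> > x" for \<omega>
    proof (cases "0 \<le> G s \<omega> - G t \<omega>")
      case True
      then show ?thesis using that assms by (intro disjI1 mult_left_mono) auto
    next
      case False
      then have "lam * x \<le> lam * (- (G s \<omega> - G t \<omega>))" using that assms by (intro mult_left_mono) auto
      then show ?thesis by (simp add: algebra_simps)
    qed
    then show "{\<omega> \<in> space M. \<bar>G s \<omega> - G t \<omega>\<bar> > x} \<subseteq> {\<omega> \<in> space M. exp (lam * (G s \<omega> - G t \<omega>)) \<ge> exp (lam * x)} \<union>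
             {\<omega> \<in> space M. exp ((- lam) * (G s \<omega> - G t \<omega>)) \<ge> exp (lam * x)}"
      unfolding exp_le_cancel_iff by blast
  qed measurable
  also have "\<dots> \<le> prob {\<omega> \<in> space M. exp (lam * (G s \<omega> - G t \<omega>)) \<ge> exp (lam * x)} +
             prob {\<omega> \<in> space M. exp ((- lam) * (G s \<omega> - G t \<omega>)) \<ge> exp (lam * x)}"
    by (rule measure_Un_le) measurable
  also have "\<dots> \<le> exp (?v - lam * x) + exp (?v - lam * x)"
    using assms by (intro add_mono one) auto
  finally show ?thesis by simp
qed

text \<open>Chebyshev: distinct summands are uncorrelated and each variance is at most 1. This gives
  tightness of \<open>G\<close> at a fixed point, uniformly over rows.\<close>

lemma prob_G_gt:
  assumes "0 < B"
  shows "prob {\<omega> \<in> space M. \<bar>G t \<omega>\<bar> > B} \<le> 1 / B\<^sup>2"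
proof -
  let ?v = "(1 + m (2 * t)) / 2 - (m t)\<^sup>2"
  have n0: "0 < real n" using n_pos by simp
  have sq: "integrable M (\<lambda>\<omega>. (X t i \<omega>)\<^sup>2)" if "i < n" for i
    using that power_mono[OF abs_X_le, of t i _ 2] by (intro integrable_const_bound[of _ 4]) auto
  have eq: "expectation (\<lambda>\<omega>. X t i \<omega> * X t j \<omega>) = (if i = j then ?v else 0)"
    and int: "integrable M (\<lambda>\<omega>. X t i \<omega> * X t j \<omega>)" if "i < n" "j < n" for i j
  proof -
    have "expectation (\<lambda>\<omega>. X t i \<omega> * X t j \<omega>) = expectation (X t i) * expectation (X t j)" if "i \<noteq> j"
    proof -
      have "indep_vars (\<lambda>_. borel) (X t) {..<n}"
        unfolding X_def by (rule indep_vars_compose2[OF indep_Z]) auto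
      then have "indep_vars (\<lambda>_. borel) (X t) {i, j}"
        using \<open>i < n\<close> \<open>j < n\<close> by (rule_tac indep_vars_subset) auto
      from indep_vars_lebesgue_integral[OF _ this] show ?thesis
        using \<open>i < n\<close> \<open>j < n\<close> that integrable_X by (auto simp: insert_commute)
    qed
    then show "expectation (\<lambda>\<omega>. X t i \<omega> * X t j \<omega>) = (if i = j then ?v else 0)"
      using that expectation_X expectation_X_square[of i t] integrable_X
      by (auto simp: power2_eq_square)
    show "integrable M (\<lambda>\<omega>. X t i \<omega> * X t j \<omega>)"
    proof (rule integrable_const_bound[of _ 4])
      have "\<bar>X t i \<omega>\<bar> * \<bar>X t j \<omega>\<bar> \<le> 2 * 2" for \<omega> by (intro mult_mono abs_X_le) auto
      then show "AE \<omega> in M. norm (X t i \<omega> * X t j \<omega>) \<le> 4" by (simp add: abs_mult)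
    qed (use that in measurable)
  qed
  have G2: "(G t \<omega>)\<^sup>2 = (\<Sum>i<n. \<Sum>j<n. X t i \<omega> * X t j \<omega>) / n" for \<omega>
    unfolding G_def power_divide by (simp add: power2_eq_square sum_product)
  have intG: "integrable M (\<lambda>\<omega>. (G t \<omega>)\<^sup>2)" unfolding G2 by (intro integrable_divide_zero Bochner_Integration.integrable_sum int) auto
  have "expectation (\<lambda>\<omega>. (G t \<omega>)\<^sup>2) = (\<Sum>i<n. \<Sum>j<n. if i = j then ?v else 0) / n"
  proof -
    have "expectation (\<lambda>\<omega>. \<Sum>i<n. \<Sum>j<n. X t i \<omega> * X t j \<omega>)
        = (\<Sum>i<n. expectation (\<lambda>\<omega>. \<Sum>j<n. X t i \<omega> * X t j \<omega>))"
      by (intro Bochner_Integration.integral_sum Bochner_Integration.integrable_sum int) auto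
    also have "\<dots> = (\<Sum>i<n. \<Sum>j<n. expectation (\<lambda>\<omega>. X t i \<omega> * X t j \<omega>))"
      by (intro sum.cong refl Bochner_Integration.integral_sum int) auto
    also have "\<dots> = (\<Sum>i<n. \<Sum>j<n. if i = j then ?v else 0)"
      by (intro sum.cong refl eq) auto
    finally show ?thesis unfolding G2 by simp
  qed
  also have "\<dots> = ?v" using n0 by simp
  finally have EG: "expectation (\<lambda>\<omega>. (G t \<omega>)\<^sup>2) \<le> 1" using variance_bounds by simp
  have "prob {\<omega> \<in> space M. \<bar>G t \<omega>\<bar> > B} \<le> prob {\<omega> \<in> space M. (G t \<omega>)\<^sup>2 \<ge> B\<^sup>2}"
    using assms by (intro finite_measure_mono) (auto intro!: abs_le_square_iff[THEN iffD1])
  also have "\<dots> \<le> expectation (\<lambda>\<omega>. (G t \<omega>)\<^sup>2) / B\<^sup>2"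
    using assms by (intro integral_Markov_inequality_measure[OF intG sets.empty_sets]) auto
  also have "\<dots> \<le> 1 / B\<^sup>2" using EG by (intro divide_right_mono) auto
  finally show ?thesis .
qed

text \<open>Averaging \<open>1 - cos (h u Z)\<close> over a standard normal \<open>u\<close> gives \<open>1 - exp (- (h Z)^2 / 2)\<close>, which dominates
  a truncated second moment although \<open>Z\<close> itself may have no moments.\<close>

lemma expectation_min_2_le:
  assumes "0 < h" "i < n"
  shows "expectation (\<lambda>\<omega>. min 2 (h * \<bar>Z i \<omega>\<bar>)) \<le> sqrt (12 * K) * h powr (\<alpha> / 2)"
proof -
  interpret N: real_distribution std_normal_distribution by (rule real_dist_normal_dist)
  interpret P: pair_prob_space M std_normal_distribution ..
  have m_eq: "expectation (\<lambda>\<omega>. cos (h * Z i \<omega> * u)) = m (h * u)" for u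
  proof -
    have "h * Z i \<omega> * u = (h * u) * Z i \<omega>" for \<omega> by simp
    then show ?thesis using expectation_cos_Z[OF assms(2)] by (simp only:)
  qed
  let ?Y = "\<lambda>\<omega>. min 2 (h * \<bar>Z i \<omega>\<bar>)"
  have meas[measurable]: "Z i \<in> borel_measurable M" using assms by simp
  have intY2: "integrable M (\<lambda>\<omega>. (?Y \<omega>)\<^sup>2)"
  proof (rule integrable_const_bound[of _ 4])
    have "(?Y \<omega>)\<^sup>2 \<le> 2\<^sup>2" for \<omega> using assms by (intro power_mono) auto
    then show "AE \<omega> in M. norm ((?Y \<omega>)\<^sup>2) \<le> 4" by simp
  qed measurable
  have intY: "integrable M ?Y"
    using assms by (intro integrable_const_bound[of _ 2]) auto
  have intp: "integrable (M \<Otimes>\<^sub>M std_normal_distribution) (\<lambda>(\<omega>, u). cos (h * Z i \<omega> * u))"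
    by (intro P.integrable_const_bound[of _ 1]) auto
  have intN2: "integrable std_normal_distribution (\<lambda>u. 1 + u\<^sup>2)"
    using integrable_std_normal_distribution_moment[of 2] by simp
  have N2: "(\<integral>u. 1 + u\<^sup>2 \<partial>std_normal_distribution) = 2"
    using integrable_std_normal_distribution_moment[of 2] std_normal_distribution_even_moments(1)[of 1] N.prob_space
    by (simp add: fact_2 del: N.space_eq_univ)
  \<comment> \<open>Jensen's inequality, read off from nonnegativity of the variance.\<close>
  have "(expectation ?Y)\<^sup>2 \<le> expectation (\<lambda>\<omega>. (?Y \<omega>)\<^sup>2)"
    using variance_eq[OF intY intY2] variance_positive[of ?Y] by linarith
  also have "\<dots> \<le> expectation (\<lambda>\<omega>. 6 * (1 - exp (- (h * Z i \<omega>)\<^sup>2 / 2)))"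
  proof (rule integral_mono[OF intY2])
    show "integrable M (\<lambda>\<omega>. 6 * (1 - exp (- (h * Z i \<omega>)\<^sup>2 / 2)))"
      by (intro integrable_mult_right Bochner_Integration.integrable_diff integrable_const
          integrable_const_bound[of _ 1]) auto
    show "(?Y \<omega>)\<^sup>2 \<le> 6 * (1 - exp (- (h * Z i \<omega>)\<^sup>2 / 2))" for \<omega>
      using min_2_squared_le[of "h * Z i \<omega>"] assms by (simp add: abs_mult)
  qed
  also have "\<dots> = 6 * (1 - expectation (\<lambda>\<omega>. exp (- (h * Z i \<omega>)\<^sup>2 / 2)))"
  proof -
    have "integrable M (\<lambda>\<omega>. exp (- (h * Z i \<omega>)\<^sup>2 / 2))"
      by (intro integrable_const_bound[of _ 1]) auto
    then show ?thesis by (simp add: prob_space)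
  qed
  also have "expectation (\<lambda>\<omega>. exp (- (h * Z i \<omega>)\<^sup>2 / 2))
      = expectation (\<lambda>\<omega>. \<integral>u. cos (h * Z i \<omega> * u) \<partial>std_normal_distribution)"
    by (simp only: integral_cos_std_normal)
  also have "\<dots> = (\<integral>u. expectation (\<lambda>\<omega>. cos (h * Z i \<omega> * u)) \<partial>std_normal_distribution)"
    using P.Fubini_integral[OF intp] by simp
  also have "\<dots> = (\<integral>u. m (h * u) \<partial>std_normal_distribution)"
    unfolding m_eq ..
  also have "1 - (\<integral>u. m (h * u) \<partial>std_normal_distribution) = (\<integral>u. 1 - m (h * u) \<partial>std_normal_distribution)"
  proof -
    \<comment> \<open>Fubini also supplies the measurability of \<open>u \<mapsto> m (h u)\<close>,
      which the locale does not state.\<close>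
    have "integrable std_normal_distribution (\<lambda>u. expectation (\<lambda>\<omega>. cos (h * Z i \<omega> * u)))"
      using P.integrable_snd[OF intp] by simp
    then have "integrable std_normal_distribution (\<lambda>u. m (h * u))" unfolding m_eq .
    then show ?thesis using N.prob_space by (simp del: N.space_eq_univ)
  qed
  \<comment> \<open>\<open>1 + u^2\<close> dominates \<open>|u|^\<alpha>\<close> and has Gaussian
    mean 2; with the earlier factor 6 this produces the 12 in the bound.\<close>
  also have "\<dots> \<le> (\<integral>u. K * h powr \<alpha> * (1 + u\<^sup>2) \<partial>std_normal_distribution)"
  proof (rule integral_mono_AE'[OF _ AE_I2 AE_I2])
    show "integrable std_normal_distribution (\<lambda>u. K * h powr \<alpha> * (1 + u\<^sup>2))"
      by (rule integrable_mult_right[OF intN2])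
    fix u
    show "0 \<le> K * h powr \<alpha> * (1 + u\<^sup>2)" using K_nonneg by simp
    have "\<bar>u\<bar> powr \<alpha> \<le> 1 + u\<^sup>2"
    proof (cases "\<bar>u\<bar> \<le> 1")
      case True
      then have "\<bar>u\<bar> powr \<alpha> \<le> 1" using \<alpha>_pos powr_mono2[of \<alpha> "\<bar>u\<bar>" 1] by simp
      then show ?thesis using zero_le_power2[of u] by linarith
    next
      case False
      then have "\<bar>u\<bar> powr \<alpha> \<le> \<bar>u\<bar> powr 2" using \<alpha>_le_1 by (intro powr_mono) auto
      also have "\<dots> = u\<^sup>2" using False by (simp add: powr_numeral)
      finally show ?thesis by linarith
    qed
    then have "K * h powr \<alpha> * \<bar>u\<bar> powr \<alpha> \<le> K * h powr \<alpha> * (1 + u\<^sup>2)"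
      using K_nonneg by (intro mult_left_mono) auto
    then show "1 - m (h * u) \<le> K * h powr \<alpha> * (1 + u\<^sup>2)"
      using one_minus_m_le[of "h * u"] assms by (simp add: abs_mult powr_mult mult.assoc)
  qed
  also have "\<dots> = K * h powr \<alpha> * 2" using N2 by simp
  finally have "(expectation ?Y)\<^sup>2 \<le> 12 * K * h powr \<alpha>" by simp
  then have "expectation ?Y \<le> sqrt (12 * K * h powr \<alpha>)" by (rule real_le_rsqrt)
  also have "\<dots> = sqrt (12 * K) * sqrt (h powr \<alpha>)" by (simp add: real_sqrt_mult)
  also have "sqrt (h powr \<alpha>) = h powr (\<alpha> / 2)" by (simp add: powr_half_sqrt[symmetric] powr_powr)
  finally show ?thesis .
qed

end

section \<open>Chaining and stochastic equicontinuity\<close>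

lemma abs_cos_diff_le: "\<bar>cos a - cos b\<bar> \<le> min 2 \<bar>a - b\<bar>" for a b :: real
proof (rule min.boundedI)
  show "\<bar>cos a - cos b\<bar> \<le> 2"
    using cos_le_one[of a] cos_le_one[of b] cos_ge_minus_one[of a] cos_ge_minus_one[of b] by linarith
  have "\<bar>cos a - cos b\<bar> = 2 * (\<bar>sin ((a + b) / 2)\<bar> * \<bar>sin ((b - a) / 2)\<bar>)"
    by (simp add: cos_diff_cos abs_mult)
  also have "\<dots> \<le> 2 * (1 * \<bar>(b - a) / 2\<bar>)"
    by (intro mult_left_mono mult_mono abs_sin_x_le_abs_x abs_sin_le_one) auto
  finally show "\<bar>cos a - cos b\<bar> \<le> \<bar>a - b\<bar>" by simp
qed

text \<open>Refining a dyadic grid once, the left neighbour of a point either stays or moves one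
  step of the finer grid to the right. Hence each level of a chain uses at most one link.\<close>

lemma nat_floor_double:
  fixes u :: real
  assumes "0 \<le> u"
  shows "nat \<lfloor>2 * u\<rfloor> = 2 * nat \<lfloor>u\<rfloor> \<or> nat \<lfloor>2 * u\<rfloor> = Suc (2 * nat \<lfloor>u\<rfloor>)"
proof -
  have "\<lfloor>2 * u\<rfloor> = 2 * \<lfloor>u\<rfloor> \<or> \<lfloor>2 * u\<rfloor> = 2 * \<lfloor>u\<rfloor> + 1" by linarith
  moreover have "0 \<le> \<lfloor>u\<rfloor>" using assms by simp
  ultimately show ?thesis by linarith
qed

context cosine_sample
begin

text \<open>Handles all pairs at distance at most \<open>h\<close> with one random variable, which
  no union bound could do. Truncation at 2 keeps its mean finite even when \<open>Z\<close> has
  none; the same truncated mean bounds \<open>|m s - m t|\<close>, hence the second term.\<close>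

lemma G_diff_le:
  assumes "\<bar>s - t\<bar> \<le> h" "0 < h"
  shows "\<bar>G s \<omega> - G t \<omega>\<bar> \<le> (\<Sum>i<n. min 2 (h * \<bar>Z i \<omega>\<bar>)) / sqrt n + sqrt n * (sqrt (12 * K) * h powr (\<alpha> / 2))"
proof -
  let ?C = "sqrt (12 * K) * h powr (\<alpha> / 2)"
  have n0: "0 < real n" using n_pos by simp
  have c: "\<bar>cos (s * Z i \<omega>) - cos (t * Z i \<omega>)\<bar> \<le> min 2 (h * \<bar>Z i \<omega>\<bar>)" for i \<omega>
  proof -
    have "\<bar>cos (s * Z i \<omega>) - cos (t * Z i \<omega>)\<bar> \<le> min 2 \<bar>s * Z i \<omega> - t * Z i \<omega>\<bar>" by (rule abs_cos_diff_le)
    also have "s * Z i \<omega> - t * Z i \<omega> = (s - t) * Z i \<omega>" by (simp add: algebra_simps)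
    also have "min 2 \<bar>(s - t) * Z i \<omega>\<bar> \<le> min 2 (h * \<bar>Z i \<omega>\<bar>)"
      unfolding abs_mult using assms by (intro min.mono mult_right_mono) auto
    finally show ?thesis .
  qed
  have "\<bar>m s - m t\<bar> = \<bar>expectation (\<lambda>\<omega>. cos (s * Z 0 \<omega>) - cos (t * Z 0 \<omega>))\<bar>"
    using n_pos expectation_cos_Z[of 0] integrable_cos_Z[of 0] by simp
  also have "\<dots> \<le> expectation (\<lambda>\<omega>. \<bar>cos (s * Z 0 \<omega>) - cos (t * Z 0 \<omega>)\<bar>)"
    by (rule integral_abs_bound)
  also have "\<dots> \<le> expectation (\<lambda>\<omega>. min 2 (h * \<bar>Z 0 \<omega>\<bar>))"
    using assms n_pos integrable_cos_Z[of 0] c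
    by (intro integral_mono integrable_const_bound[of _ 2]) auto
  also have "\<dots> \<le> ?C" by (rule expectation_min_2_le) (use assms n_pos in auto)
  finally have mm: "\<bar>m s - m t\<bar> \<le> ?C" .
  have "\<bar>G s \<omega> - G t \<omega>\<bar> = \<bar>\<Sum>i<n. X s i \<omega> - X t i \<omega>\<bar> / sqrt n"
    by (simp add: G_def sum_subtractf diff_divide_distrib[symmetric])
  also have "\<dots> \<le> (\<Sum>i<n. \<bar>X s i \<omega> - X t i \<omega>\<bar>) / sqrt n"
    by (intro divide_right_mono sum_abs) auto
  also have "\<dots> \<le> (\<Sum>i<n. min 2 (h * \<bar>Z i \<omega>\<bar>) + ?C) / sqrt n"
  proof (intro divide_right_mono sum_mono)
    fix i
    show "\<bar>X s i \<omega> - X t i \<omega>\<bar> \<le> min 2 (h * \<bar>Z i \<omega>\<bar>) + ?C"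
      unfolding X_def using c[of i \<omega>] mm by linarith
  qed auto
  also have "\<dots> = (\<Sum>i<n. min 2 (h * \<bar>Z i \<omega>\<bar>)) / sqrt n + (n / sqrt n) * ?C"
    by (simp add: sum.distrib add_divide_distrib)
  also have "n / sqrt n = sqrt n" by (rule real_div_sqrt) simp
  finally show ?thesis .
qed

text \<open>A link at level \<open>j\<close> has variance at most \<open>2 K r^(-8 j)\<close>. Taking the exponential moment at \<open>r^(2 j)\<close>
  and the threshold \<open>r^(-j)\<close>, the \<open>2^j\<close> failure probabilities \<open>2 exp (2 K - r^j)\<close> and the thresholds are both
  summable. \<open>D\<close> bounds the oscillation of the means below the finest level.\<close>

lemma chaining:
  fixes b \<eta> :: real and j0 J :: nat
  defines "r \<equiv> 2 powr (\<alpha> / 8)"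
  defines "D \<equiv> sqrt n * (sqrt (12 * K) / r ^ (4 * J))"
  assumes "j0 \<le> J" and J: "4 * r ^ (2 * J) \<le> sqrt n" and \<eta>: "0 < \<eta>"
  obtains E where "E \<in> events"
    "prob E \<le> (\<Sum>j\<in>{j0<..J}. 2 * 2 ^ j * exp (2 * K - r ^ j)) + D / \<eta>"
    "\<And>\<omega> u. \<omega> \<in> space M - E \<Longrightarrow> 0 \<le> u \<Longrightarrow> u < 1 / 2 ^ j0 \<Longrightarrow>
        \<bar>G (b + u) \<omega> - G b \<omega>\<bar> \<le> (\<Sum>j\<in>{j0<..J}. 1 / r ^ j) + \<eta> + D"
proof
  let ?h = "1 / 2 ^ J :: real"
  let ?p = "\<lambda>j i. b + real i / 2 ^ j"
  let ?A = "\<lambda>j i. {\<omega> \<in> space M. \<bar>G (?p j (Suc i)) \<omega> - G (?p j i) \<omega>\<bar> > 1 / r ^ j}"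
  let ?R = "\<lambda>\<omega>. (\<Sum>i<n. min 2 (?h * \<bar>Z i \<omega>\<bar>)) / sqrt n"
  let ?U = "\<Union>j\<in>{j0<..J}. \<Union>i\<in>{..<2 ^ j}. ?A j i"
  let ?V = "{\<omega> \<in> space M. ?R \<omega> \<ge> \<eta>}"
  have n0: "0 < real n" using n_pos by simp
  have r_pos: "0 < r" by (simp add: r_def)
  have r1: "1 \<le> r" using \<alpha>_pos by (simp add: r_def ge_one_powr_ge_zero)
  have r_pow: "r ^ k = 2 powr (\<alpha> * k / 8)" for k
  proof -
    have "r ^ k = r powr (real k)" using r_pos by (simp add: powr_realpow)
    then show ?thesis by (simp add: r_def powr_powr)
  qed
  have half_pow: "(1 / 2 ^ k :: real) = 2 powr (- real k)" for k
    by (simp add: powr_minus powr_realpow divide_inverse)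
  have h\<alpha>: "?h powr (\<alpha> / 2) = 1 / r ^ (4 * J)"
    unfolding r_pow half_pow powr_powr powr_minus_divide[symmetric] by (simp add: algebra_simps)
  have A: "prob (?A j i) \<le> 2 * exp (2 * K - r ^ j)" if j: "j \<le> J" for j i
  proof -
    have "r ^ (2 * j) \<le> r ^ (2 * J)" using j r1 by (intro power_increasing) auto
    then have l: "4 * r ^ (2 * j) \<le> sqrt n" using J by linarith
    have d: "\<bar>?p j (Suc i) - ?p j i\<bar> = 1 / 2 ^ j" by (simp add: add_divide_distrib)
    have "prob (?A j i) \<le> 2 * exp ((r ^ (2 * j))\<^sup>2 * (2 * K * (1 / 2 ^ j) powr \<alpha>) - r ^ (2 * j) * (1 / r ^ j))"
      using G_diff_tail[where lam = "r ^ (2 * j)" and s = "?p j (Suc i)" and t = "?p j i" and x = "1 / r ^ j"] l r_pos unfolding d by simp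
    also have "\<dots> \<le> 2 * exp (2 * K - r ^ j)"
    proof -
      \<comment> \<open>As \<open>2 powr \<alpha> = r ^ 8\<close>, the product equals
        \<open>r ^ (4 * j) / r ^ (8 * j) \<le> 1\<close>, so the quadratic part of the exponent
        stays below \<open>2 * K\<close> at every level.\<close>
      have "(r ^ (2 * j))\<^sup>2 * (1 / 2 ^ j) powr \<alpha> = r ^ (4 * j) * (1 / 2 ^ j) powr \<alpha>"
        by (simp add: power_mult[symmetric] mult.commute)
      also have "\<dots> = 2 powr (- (\<alpha> * j / 2))"
        unfolding r_pow half_pow powr_powr powr_add[symmetric] by (simp add: algebra_simps)
      also have "\<dots> \<le> 2 powr 0" using \<alpha>_pos by (intro powr_mono) auto
      finally have "2 * K * ((r ^ (2 * j))\<^sup>2 * (1 / 2 ^ j) powr \<alpha>) \<le> 2 * K * 1"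
        using K_nonneg by (intro mult_left_mono) auto
      moreover have "r ^ (2 * j) * (1 / r ^ j) = r ^ j"
        using r_pos by (simp add: mult_2 power_add)
      ultimately show ?thesis by (simp add: mult_ac)
    qed
    finally show ?thesis .
  qed
  have R_int: "integrable M ?R"
    by (intro integrable_divide_zero Bochner_Integration.integrable_sum integrable_const_bound[of _ 2]) auto
  show ev: "?U \<union> ?V \<in> events" by measurable
  have "prob ?U \<le> (\<Sum>j\<in>{j0<..J}. prob (\<Union>i\<in>{..<2 ^ j}. ?A j i))"
    by (rule measure_UNION_le) auto
  also have "\<dots> \<le> (\<Sum>j\<in>{j0<..J}. \<Sum>i\<in>{..<2 ^ j}. prob (?A j i))"
    by (intro sum_mono measure_UNION_le) auto
  also have "\<dots> \<le> (\<Sum>j\<in>{j0<..J}. \<Sum>i\<in>{..<2 ^ j :: nat}. 2 * exp (2 * K - r ^ j))"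
    by (intro sum_mono A) auto
  also have "\<dots> = (\<Sum>j\<in>{j0<..J}. 2 * 2 ^ j * exp (2 * K - r ^ j))"
    by (simp add: mult_ac)
  finally have U: "prob ?U \<le> (\<Sum>j\<in>{j0<..J}. 2 * 2 ^ j * exp (2 * K - r ^ j))" .
  have "prob ?V \<le> expectation ?R / \<eta>"
    by (rule integral_Markov_inequality_measure[OF R_int sets.empty_sets])
      (auto intro!: AE_I2 divide_nonneg_nonneg sum_nonneg \<eta>)
  also have "expectation ?R = (\<Sum>i<n. expectation (\<lambda>\<omega>. min 2 (?h * \<bar>Z i \<omega>\<bar>))) / sqrt n"
  proof -
    have "integrable M (\<lambda>\<omega>. min 2 (?h * \<bar>Z i \<omega>\<bar>))" if "i < n" for i
      using that by (intro integrable_const_bound[of _ 2]) auto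
    then show ?thesis by simp
  qed
  also have "\<dots> \<le> (\<Sum>i<n. sqrt (12 * K) * ?h powr (\<alpha> / 2)) / sqrt n"
    by (intro divide_right_mono sum_mono expectation_min_2_le) auto
  also have "\<dots> = (n / sqrt n) * (sqrt (12 * K) / r ^ (4 * J))"
    unfolding h\<alpha> by simp
  also have "n / sqrt n = sqrt n" by (rule real_div_sqrt) simp
  finally have V: "prob ?V \<le> D / \<eta>" using \<eta> by (simp add: D_def divide_right_mono)
  have "prob (?U \<union> ?V) \<le> prob ?U + prob ?V"
    by (rule measure_Un_le) measurable
  with U V show "prob (?U \<union> ?V) \<le> (\<Sum>j\<in>{j0<..J}. 2 * 2 ^ j * exp (2 * K - r ^ j)) + D / \<eta>"
    by linarith
  fix \<omega> and u :: real
  assume \<omega>: "\<omega> \<in> space M - (?U \<union> ?V)" and u: "0 \<le> u" "u < 1 / 2 ^ j0"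
  have link: "\<bar>G (?p j (Suc i)) \<omega> - G (?p j i) \<omega>\<bar> \<le> 1 / r ^ j" if "j0 < j" "j \<le> J" "i < 2 ^ j" for i j
    using \<omega> that by (auto simp: not_less)
  let ?k = "\<lambda>j. nat \<lfloor>u * 2 ^ j\<rfloor>"
  \<comment> \<open>\<open>?k j\<close> indexes the grid point at or just left of
    \<open>b + u\<close>. At level \<open>j0\<close> it is 0 because \<open>u < 1 / 2 ^ j0\<close>,
    so every chain starts at \<open>b\<close> itself.\<close>
  have chain: "\<bar>G (?p j (?k j)) \<omega> - G b \<omega>\<bar> \<le> (\<Sum>i\<in>{j0<..j}. 1 / r ^ i)" if "j0 \<le> j" "j \<le> J" for j
    using that
  proof (induction j rule: dec_induct)
    case base
    have "u * 2 ^ j0 < 1" using u by (simp add: field_simps)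
    then have "?k j0 = 0" using u by (simp add: floor_eq_iff)
    then show ?case by simp
  next
    case (step j)
    have "?k (Suc j) = 2 * ?k j \<or> ?k (Suc j) = Suc (2 * ?k j)"
      using nat_floor_double[of "u * 2 ^ j"] u by (simp add: mult_ac)
    moreover have eq: "?p (Suc j) (2 * i) = ?p j i" for i by simp
    moreover have "2 * ?k j < 2 ^ Suc j"
    proof -
      have "u * 2 ^ j < 2 ^ j" using u by (simp add: field_simps less_le_trans[of u "1 / 2 ^ j0" 1])
      then have "\<lfloor>u * 2 ^ j\<rfloor> < 2 ^ j" by (simp add: floor_less_iff)
      then have "?k j < 2 ^ j" using u by (simp add: nat_less_iff)
      then show ?thesis by simp
    qed
    \<comment> \<open>A doubled index is the same point; otherwise the move is a single link
      starting at an even index.\<close>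
    ultimately have "\<bar>G (?p (Suc j) (?k (Suc j))) \<omega> - G (?p j (?k j)) \<omega>\<bar> \<le> 1 / r ^ Suc j"
      using link[of "Suc j" "2 * ?k j"] step r_pos by (auto simp del: of_nat_mult of_nat_Suc of_nat_numeral power_Suc)
    moreover have "{j0<..Suc j} = insert (Suc j) {j0<..j}" using step by auto
    ultimately show ?case using step by simp
  qed
  have "\<bar>(b + u) - ?p J (?k J)\<bar> \<le> ?h"
  proof -
    have "\<bar>u * 2 ^ J - ?k J\<bar> \<le> 1" using u by (simp add: abs_le_iff) linarith
    then show ?thesis by (simp add: field_simps abs_le_iff)
  qed
  then have "\<bar>G (b + u) \<omega> - G (?p J (?k J)) \<omega>\<bar> \<le> ?R \<omega> + D"
    using G_diff_le[of "b + u" "?p J (?k J)" ?h \<omega>] unfolding h\<alpha> by (simp add: D_def)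
  moreover have "?R \<omega> < \<eta>" using \<omega> by auto
  ultimately show "\<bar>G (b + u) \<omega> - G b \<omega>\<bar> \<le> (\<Sum>j\<in>{j0<..J}. 1 / r ^ j) + \<eta> + D"
    using chain[of J] \<open>j0 \<le> J\<close> by linarith
qed

end

text \<open>\<open>r ^ j\<close> may grow slowly, as \<open>r\<close> can be close to 1. Taking
  \<open>k\<close> with \<open>r ^ k > 4\<close>, the single term of order \<open>k\<close> of the
  exponential series gives \<open>exp (r ^ j) \<ge> 4 ^ j / k!\<close>, so the summands decay like
  \<open>2^(-j)\<close>.\<close>

lemma summable_pow2_exp_minus_pow:
  fixes r C :: real
  assumes "1 < r"
  shows "summable (\<lambda>j::nat. 2 * 2 ^ j * exp (C - r ^ j))"
proof -
  obtain k :: nat where k: "4 < r ^ k" using real_arch_pow[OF assms] by blast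
  have b: "norm (2 * 2 ^ j * exp (C - r ^ j)) \<le> 2 * exp C * fact k * (1 / 2) ^ j" for j :: nat
  proof -
    have "(r ^ j) ^ k / fact k \<le> exp (r ^ j)"
    proof -
      have nn: "0 \<le> (r ^ j) ^ i /\<^sub>R fact i" for i using assms by simp
      have s: "summable (\<lambda>i. (r ^ j) ^ i /\<^sub>R fact i)" by (rule summable_exp_generic)
      have "(\<Sum>i\<in>{k}. (r ^ j) ^ i /\<^sub>R fact i) \<le> (\<Sum>i. (r ^ j) ^ i /\<^sub>R fact i)"
        by (rule sum_le_suminf[OF s]) (use nn in auto)
      then have "(r ^ j) ^ k /\<^sub>R fact k \<le> exp (r ^ j)" unfolding exp_def by simp
      then show ?thesis by (simp add: divide_inverse_commute)
    qed
    moreover have "4 ^ j \<le> (r ^ j) ^ k"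
    proof -
      have "4 ^ j \<le> (r ^ k) ^ j" using k by (intro power_mono) auto
      then show ?thesis by (simp only: power_mult[symmetric] mult.commute[of j k])
    qed
    ultimately have "4 ^ j / fact k \<le> exp (r ^ j)"
      using divide_right_mono[of "4 ^ j" "(r ^ j) ^ k" "fact k"] by simp
    then have "1 / exp (r ^ j) \<le> 1 / (4 ^ j / fact k)"
      by (intro divide_left_mono) auto
    then have "exp (- (r ^ j)) \<le> fact k / 4 ^ j"
      by (simp add: exp_minus inverse_eq_divide)
    then have "2 * 2 ^ j * exp C * exp (- (r ^ j)) \<le> 2 * 2 ^ j * exp C * (fact k / 4 ^ j)"
      by (intro mult_left_mono) auto
    also have "\<dots> = 2 * exp C * fact k * (1 / 2) ^ j"
    proof -
      have "(4::real) ^ j = 2 ^ j * 2 ^ j" by (simp add: power_mult_distrib[symmetric])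
      then show ?thesis by (simp add: power_divide)
    qed
    finally show ?thesis by (simp add: diff_conv_add_uminus exp_add mult.assoc del: add_uminus_conv_diff)
  qed
  have "summable (\<lambda>j::nat. 2 * exp C * fact k * (1 / 2) ^ j)"
    using summable_mult[OF summable_geometric[of "1 / 2 :: real"], of "2 * exp C * fact k"] by simp
  then show ?thesis using b by (rule summable_comparison_test')
qed

text \<open>Uniformity in \<open>J\<close> matters: \<open>j0\<close> is fixed beforehand, whereas
  the finest level grows with the sample size.\<close>

lemma sum_tail_small:
  fixes f :: "nat \<Rightarrow> real"
  assumes "summable f" "0 < e"
  shows "eventually (\<lambda>j0. \<forall>J. (\<Sum>j\<in>{j0<..J}. f j) \<le> e) sequentially"
proof -
  obtain N where N: "\<And>m n. N \<le> m \<Longrightarrow> norm (sum f {m..<n}) < e"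
    using assms summable_Cauchy[of f] by blast
  have "(\<Sum>j\<in>{j0<..J}. f j) \<le> e" if "N \<le> j0" for j0 J
  proof -
    have "{j0<..J} = {Suc j0..<Suc J}" by auto
    then show ?thesis using N[of "Suc j0" "Suc J"] that by (simp add: abs_le_iff)
  qed
  then show ?thesis by (auto simp: eventually_sequentially)
qed

text \<open>The number of dyadic levels is of order \<open>log n\<close>: deep enough for the remainder below
  the finest level to vanish, but shallow enough for the exponential moment bound to apply at every level.\<close>

lemma equicontinuity:
  fixes K \<alpha> c \<eta> :: real
  assumes \<eta>: "0 < \<eta>" and \<alpha>: "0 < \<alpha>" "\<alpha> \<le> 1"
  shows "\<exists>\<delta>>0. \<exists>N. \<forall>n\<ge>N. \<forall>(M :: 'w measure) Z m. cosine_sample M n Z m K \<alpha> \<longrightarrow>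
    (\<exists>E\<in>sets M. measure M E \<le> \<eta> \<and> (\<forall>\<omega>\<in>space M - E. \<forall>s. \<bar>s - c\<bar> < \<delta> \<longrightarrow>
       \<bar>cosine_sample.G n Z m s \<omega> - cosine_sample.G n Z m c \<omega>\<bar> \<le> \<eta>))"
proof -
  define r where "r = 2 powr (\<alpha> / 8)"
  have r1: "1 < r" using \<alpha> by (simp add: r_def)
  have r2: "r \<le> 2"
  proof -
    have "r \<le> 2 powr 1" unfolding r_def using \<alpha> by (intro powr_mono) auto
    then show ?thesis by simp
  qed
  have s1: "summable (\<lambda>j. 1 / r ^ j)"
    using summable_geometric[of "1 / r"] r1 by (simp add: power_divide)
  have "eventually (\<lambda>j0. (\<forall>J. (\<Sum>j\<in>{j0<..J}. 1 / r ^ j) \<le> \<eta> / 8) \<and>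
      (\<forall>J. (\<Sum>j\<in>{j0<..J}. 2 * 2 ^ j * exp (2 * K - r ^ j)) \<le> \<eta> / 8)) sequentially"
    using \<eta> by (intro eventually_conj sum_tail_small s1 summable_pow2_exp_minus_pow r1) auto
  then obtain j0 where j0: "\<And>J. (\<Sum>j\<in>{j0<..J}. 1 / r ^ j) \<le> \<eta> / 8"
      "\<And>J. (\<Sum>j\<in>{j0<..J}. 2 * 2 ^ j * exp (2 * K - r ^ j)) \<le> \<eta> / 8"
    by (auto simp: eventually_sequentially)
  \<comment> \<open>With \<open>D < e\<close>, the first entry gives
    \<open>D \<le> \<eta> / 8\<close>, the second gives
    \<open>D / (\<eta> / 8) \<le> \<eta> / 2\<close> for the Markov term.\<close>
  define e where "e = min (\<eta> / 8) (\<eta>\<^sup>2 / 16)"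
  have e: "0 < e" using \<eta> by (simp add: e_def)
  \<comment> \<open>256 is \<open>16 * 2 ^ 4\<close>: squaring
    \<open>sqrt n < 4 r^(2 (J + 1))\<close> gives \<open>n \<le> 16 r^4 r^(4 J)\<close>, and
    \<open>r \<le> 2\<close>.\<close>
  have "((\<lambda>n. 256 * sqrt (12 * K) / sqrt (real n)) \<longlongrightarrow> 0) sequentially"
    by (intro tendsto_divide_0[OF tendsto_const] filterlim_at_top_imp_at_infinity
        filterlim_compose[OF sqrt_at_top filterlim_real_sequentially])
  then have "eventually (\<lambda>n. 256 * sqrt (12 * K) / sqrt (real n) < e) sequentially"
    using e by (rule order_tendstoD)
  moreover have "eventually (\<lambda>n. 4 * r ^ (2 * j0) \<le> sqrt (real n)) sequentially"
    using filterlim_compose[OF sqrt_at_top filterlim_real_sequentially]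
    by (auto simp: filterlim_at_top)
  ultimately have "eventually (\<lambda>n. 256 * sqrt (12 * K) / sqrt (real n) < e \<and> 4 * r ^ (2 * j0) \<le> sqrt (real n)) sequentially"
    by (rule eventually_conj)
  then obtain N where N: "\<And>n. N \<le> n \<Longrightarrow> 256 * sqrt (12 * K) / sqrt (real n) < e"
      "\<And>n. N \<le> n \<Longrightarrow> 4 * r ^ (2 * j0) \<le> sqrt (real n)"
    unfolding eventually_sequentially by blast
  \<comment> \<open>The chain only runs to the right of its base point. Starting at
    \<open>c - \<delta>\<close>, an interval of length \<open>2 \<delta> = 1 / 2 ^ j0\<close>
    contains \<open>c\<close> and every \<open>s\<close> considered, so both are compared with the
    base point.\<close>
  define \<delta> :: real where "\<delta> = 1 / 2 ^ j0 / 2"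
  have \<delta>: "0 < \<delta>" by (simp add: \<delta>_def)
  show ?thesis
  proof (intro exI[of _ \<delta>] conjI \<delta> exI[of _ N] allI impI)
    fix n :: nat and M :: "'w measure" and Z m
    assume n: "N \<le> n" and "cosine_sample M n Z m K \<alpha>"
    then interpret cosine_sample M n Z m K \<alpha> by simp
    let ?P = "\<lambda>J. sqrt (real n) < 4 * r ^ (2 * Suc J)"
    have "1 < r\<^sup>2" using r1 by (simp add: one_less_power)
    then obtain J0 where "sqrt (real n) / 4 < (r\<^sup>2) ^ J0" using real_arch_pow by blast
    also have "\<dots> \<le> (r\<^sup>2) ^ Suc J0" using r1 by (intro power_increasing) auto
    finally have "?P J0" unfolding power_mult by simp
    then have ex: "\<exists>J. ?P J" by blast
    \<comment> \<open>The last level at which the exponential moment bound is admissible: the next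
      one already violates it, which bounds \<open>J\<close> from below.\<close>
    define J where "J = (LEAST J. ?P J)"
    have PJ: "?P J" unfolding J_def using ex by (rule LeastI_ex)
    have big: "4 * r ^ (2 * J) \<le> sqrt n"
    proof (cases J)
      case 0
      have "1 \<le> r ^ (2 * j0)" using r1 by (intro one_le_power) auto
      then show ?thesis using N(2)[OF n] 0 by simp
    next
      case (Suc J')
      then have "\<not> ?P J'" unfolding J_def by (intro not_less_Least) auto
      then show ?thesis using Suc by (simp only: not_less)
    qed
    have j0J: "j0 \<le> J"
    proof (rule ccontr)
      assume "\<not> j0 \<le> J"
      then have "r ^ (2 * Suc J) \<le> r ^ (2 * j0)" using r1 by (intro power_increasing) auto
      then show False using PJ N(2)[OF n] by linarith
    qed
    define D where "D = sqrt n * (sqrt (12 * K) / r ^ (4 * J))"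
    have n0: "0 < real n" using n_pos by simp
    have "D \<le> 256 * sqrt (12 * K) / sqrt (real n)"
    proof -
      have "(sqrt (real n))\<^sup>2 \<le> (4 * r ^ (2 * Suc J))\<^sup>2" using PJ by (intro power_mono) auto
      also have "\<dots> = 16 * r ^ 4 * r ^ (4 * J)"
      proof -
        have "(r ^ (2 * Suc J))\<^sup>2 = r ^ (4 + 4 * J)" unfolding power_mult[symmetric] by (rule arg_cong) simp
        then show ?thesis by (simp add: power_mult_distrib power_add)
      qed
      also have "\<dots> \<le> 16 * 2 ^ 4 * r ^ (4 * J)"
        using r1 r2 by (intro mult_right_mono mult_left_mono power_mono) auto
      finally have "real n \<le> 256 * r ^ (4 * J)" by simp
      then have "1 / r ^ (4 * J) \<le> 256 / n" using n0 r1 by (simp add: field_simps)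
      then have "sqrt n * (sqrt (12 * K) * (1 / r ^ (4 * J))) \<le> sqrt n * (sqrt (12 * K) * (256 / n))"
        using K_nonneg by (intro mult_left_mono) auto
      also have "\<dots> = 256 * sqrt (12 * K) * (sqrt n / n)" by simp
      also have "sqrt n / n = 1 / sqrt n" by (simp add: sqrt_divide_self_eq inverse_eq_divide)
      finally show ?thesis by (simp add: D_def)
    qed
    also have "\<dots> < e" by (rule N(1)[OF n])
    finally have De: "D < e" .
    obtain E where E: "E \<in> events"
      "prob E \<le> (\<Sum>j\<in>{j0<..J}. 2 * 2 ^ j * exp (2 * K - r ^ j)) + D / (\<eta> / 8)"
      "\<And>\<omega> u. \<omega> \<in> space M - E \<Longrightarrow> 0 \<le> u \<Longrightarrow> u < 1 / 2 ^ j0 \<Longrightarrow>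
        \<bar>G ((c - \<delta>) + u) \<omega> - G (c - \<delta>) \<omega>\<bar> \<le> (\<Sum>j\<in>{j0<..J}. 1 / r ^ j) + \<eta> / 8 + D"
      using chaining[OF j0J, folded r_def, OF big, of "\<eta> / 8" "c - \<delta>"] \<eta> unfolding D_def by auto
    show "\<exists>E\<in>events. prob E \<le> \<eta> \<and> (\<forall>\<omega>\<in>space M - E. \<forall>s. \<bar>s - c\<bar> < \<delta> \<longrightarrow> \<bar>G s \<omega> - G c \<omega>\<bar> \<le> \<eta>)"
    proof (intro bexI[OF _ E(1)] conjI ballI allI impI)
      have "D / (\<eta> / 8) \<le> (\<eta>\<^sup>2 / 16) / (\<eta> / 8)"
        using De \<eta> by (intro divide_right_mono) (auto simp: e_def)
      also have "\<dots> = \<eta> / 2" using \<eta> by (simp add: power2_eq_square)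
      finally show "prob E \<le> \<eta>" using E(2) j0(2)[of J] \<eta> by linarith
    next
      fix \<omega> s
      assume \<omega>: "\<omega> \<in> space M - E" and s: "\<bar>s - c\<bar> < \<delta>"
      \<comment> \<open>Each of the two comparisons with the base point costs at most
        \<open>3 \<eta> / 8\<close>.\<close>
      have "\<bar>G (c - \<delta> + (s - (c - \<delta>))) \<omega> - G (c - \<delta>) \<omega>\<bar> \<le> (\<Sum>j\<in>{j0<..J}. 1 / r ^ j) + \<eta> / 8 + D"
        using s by (intro E(3)[OF \<omega>]) (auto simp: \<delta>_def)
      moreover have "\<bar>G (c - \<delta> + \<delta>) \<omega> - G (c - \<delta>) \<omega>\<bar> \<le> (\<Sum>j\<in>{j0<..J}. 1 / r ^ j) + \<eta> / 8 + D"
        by (intro E(3)[OF \<omega>]) (auto simp: \<delta>_def field_simps)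
      moreover have "D \<le> \<eta> / 8" using De by (simp add: e_def)
      ultimately show "\<bar>G s \<omega> - G c \<omega>\<bar> \<le> \<eta>" using j0(1)[of J] \<eta> by simp
    qed
  qed
qed

section \<open>Slutsky's lemma and the logarithm\<close>

lemma cmod_iexp_diff_le: "cmod (iexp a - iexp b) \<le> \<bar>a - b\<bar>" for a b :: real
proof -
  have "iexp a - iexp b = iexp b * (iexp (a - b) - 1)"
    by (simp add: right_diff_distrib exp_add[symmetric])
  then have "cmod (iexp a - iexp b) = cmod (iexp (a - b) - 1)"
    by (simp add: norm_mult)
  also have "\<dots> \<le> \<bar>a - b\<bar>" using iexp_approx1[of "a - b" 0] by simp
  finally show ?thesis .
qed

text \<open>Both facts are carried over from the standard normal law along multiplication by
  \<open>sqrt v\<close>.\<close>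

lemma
  assumes "0 < v"
  shows real_distribution_normal_law: "real_distribution (normal_law v)"
    and char_normal_law: "char (normal_law v) t = complex_of_real (exp (- t\<^sup>2 * v / 2))"
proof -
  interpret N: real_distribution std_normal_distribution by (rule real_dist_normal_dist)
  have "distributed std_normal_distribution lborel (\<lambda>x. x) std_normal_density"
    by (auto simp: distributed_def intro!: measure_eqI simp: emeasure_distr)
  then have "distributed std_normal_distribution lborel (\<lambda>x. 0 + sqrt v * x) (normal_density (0 + sqrt v * 0) (\<bar>sqrt v\<bar> * 1))"
    using assms by (intro N.normal_density_affine) auto
  then have "distr std_normal_distribution lborel (\<lambda>x. sqrt v * x) = normal_law v"
    using assms by (simp add: normal_law_def distributed_distr_eq_density)
  then have eq: "normal_law v = distr std_normal_distribution borel (\<lambda>x. sqrt v * x)"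
    by (metis distr_cong sets_lborel)
  show "real_distribution (normal_law v)"
    unfolding eq by (rule N.real_distribution_distr) simp
  have "char (normal_law v) t = char std_normal_distribution (t * sqrt v)"
    unfolding eq char_def by (subst integral_distr) (auto simp: mult.assoc)
  then show "char (normal_law v) t = complex_of_real (exp (- t\<^sup>2 * v / 2))"
    using assms by (simp add: char_std_normal_distribution power_mult_distrib)
qed

text \<open>Slutsky's lemma on the level of characteristic functions: off \<open>E\<close> the
  integrands differ by at most \<open>|u| e\<close>, on \<open>E\<close> by at most 2. Closeness is
  phrased by an exceptional event in each space, since the spaces vary with
  \<open>k\<close>.\<close>

lemma weak_conv_normal_law_perturbed:
  fixes M :: "nat \<Rightarrow> 'w measure" and D Y :: "nat \<Rightarrow> 'w \<Rightarrow> real"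
  assumes "0 < v"
    and prob: "\<And>k. prob_space (M k)"
    and D[measurable]: "\<And>k. D k \<in> borel_measurable (M k)"
    and Y[measurable]: "\<And>k. Y k \<in> borel_measurable (M k)"
    and char_Y: "\<And>u. (\<lambda>k. char (distr (M k) borel (Y k)) u) \<longlonglongrightarrow> complex_of_real (exp (- u\<^sup>2 * v / 2))"
    and close: "\<And>e. 0 < e \<Longrightarrow> eventually (\<lambda>k. \<exists>E\<in>sets (M k). measure (M k) E \<le> e \<and>
        (\<forall>\<omega>\<in>space (M k) - E. \<bar>D k \<omega> - Y k \<omega>\<bar> \<le> e)) sequentially"
  shows "weak_conv_m (\<lambda>k. distr (M k) borel (D k)) (normal_law v)"
proof (rule levy_continuity)
  show "real_distribution (distr (M k) borel (D k))" for k
    using prob_space.real_distribution_distr[OF prob D] .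
  show "real_distribution (normal_law v)" by (rule real_distribution_normal_law) fact
  fix u
  have "(\<lambda>k. char (distr (M k) borel (D k)) u - char (distr (M k) borel (Y k)) u) \<longlonglongrightarrow> 0"
  proof (rule tendstoI)
    fix e :: real assume "0 < e"
    \<comment> \<open>Chosen so that the total error \<open>|u| e' + 2 e'\<close> stays below
      \<open>e\<close>.\<close>
    define e' where "e' = e / (2 * (\<bar>u\<bar> + 3))"
    have e': "0 < e'" using \<open>0 < e\<close> by (simp add: e'_def)
    show "eventually (\<lambda>k. dist (char (distr (M k) borel (D k)) u - char (distr (M k) borel (Y k)) u) 0 < e) sequentially"
      using close[OF e']
    proof eventually_elim
      case (elim k)
      then obtain E where E[measurable]: "E \<in> sets (M k)" and mE: "measure (M k) E \<le> e'"
        and d: "\<And>\<omega>. \<omega> \<in> space (M k) - E \<Longrightarrow> \<bar>D k \<omega> - Y k \<omega>\<bar> \<le> e'" by auto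
      interpret prob_space "M k" by (rule prob)
      have int: "integrable (M k) (\<lambda>\<omega>. iexp (u * D k \<omega>))" "integrable (M k) (\<lambda>\<omega>. iexp (u * Y k \<omega>))"
        by (intro integrable_iexp; simp)+
      have "char (distr (M k) borel (D k)) u - char (distr (M k) borel (Y k)) u
          = (CLINT \<omega>|M k. iexp (u * D k \<omega>) - iexp (u * Y k \<omega>))"
        unfolding char_def using int by (simp add: integral_distr)
      then have "cmod (char (distr (M k) borel (D k)) u - char (distr (M k) borel (Y k)) u)
          \<le> expectation (\<lambda>\<omega>. cmod (iexp (u * D k \<omega>) - iexp (u * Y k \<omega>)))"
        using integral_norm_bound by simp
      also have "\<dots> \<le> expectation (\<lambda>\<omega>. \<bar>u\<bar> * e' + 2 * indicator E \<omega>)"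
      proof (rule integral_mono)
        show "integrable (M k) (\<lambda>\<omega>. cmod (iexp (u * D k \<omega>) - iexp (u * Y k \<omega>)))"
          using int by (intro integrable_norm Bochner_Integration.integrable_diff)
        show "integrable (M k) (\<lambda>\<omega>. \<bar>u\<bar> * e' + 2 * indicator E \<omega>)"
          by (intro Bochner_Integration.integrable_add integrable_mult_right integrable_real_indicator) (auto simp: emeasure_eq_measure)
        fix \<omega> assume \<omega>: "\<omega> \<in> space (M k)"
        show "cmod (iexp (u * D k \<omega>) - iexp (u * Y k \<omega>)) \<le> \<bar>u\<bar> * e' + 2 * indicator E \<omega>"
        proof (cases "\<omega> \<in> E")
          case True
          have "cmod (iexp (u * D k \<omega>) - iexp (u * Y k \<omega>)) \<le> 1 + 1"
            by (rule order_trans[OF norm_triangle_ineq4]) simp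
          then show ?thesis using True e' by (simp add: add_increasing)
        next
          case False
          have "cmod (iexp (u * D k \<omega>) - iexp (u * Y k \<omega>)) \<le> \<bar>u * D k \<omega> - u * Y k \<omega>\<bar>"
            by (rule cmod_iexp_diff_le)
          also have "\<dots> = \<bar>u\<bar> * \<bar>D k \<omega> - Y k \<omega>\<bar>" by (simp add: abs_mult[symmetric] right_diff_distrib)
          also have "\<dots> \<le> \<bar>u\<bar> * e'" using d[of \<omega>] \<omega> False by (intro mult_left_mono) auto
          finally show ?thesis using False by simp
        qed
      qed
      also have "\<dots> = \<bar>u\<bar> * e' + 2 * prob E"
        by (subst Bochner_Integration.integral_add) (auto simp: prob_space emeasure_eq_measure)
      also have "\<dots> \<le> (\<bar>u\<bar> + 3) * e'" using mE e' by (simp add: algebra_simps)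
      also have "\<dots> = e / 2"
      proof -
        have "w * (e / (2 * w)) = e / 2" if "w \<noteq> 0" for w :: real using that by simp
        moreover have "\<bar>u\<bar> + 3 \<noteq> 0" using abs_ge_zero[of u] by linarith
        ultimately show ?thesis unfolding e'_def by blast
      qed
      also have "\<dots> < e" using \<open>0 < e\<close> by simp
      finally show ?case by simp
    qed
  qed
  from tendsto_add[OF this char_Y[of u]]
  show "(\<lambda>k. char (distr (M k) borel (D k)) u) \<longlonglongrightarrow> char (normal_law v) u"
    using char_normal_law[OF \<open>0 < v\<close>] by simp
qed

text \<open>Deterministic delta method. With weight \<open>W = 1 / (|s|^q m)\<close>, the error
  splits into the second order term of \<open>ln\<close>, the change from \<open>g\<close> to
  \<open>g0\<close>, and the change of the weight, each at most \<open>\<eta> / 3\<close>. The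
  tolerances precede all variables, so the result applies pointwise in
  \<open>\<omega>\<close>.\<close>

lemma log_expansion:
  fixes c q m0 B \<eta> :: real
  assumes "0 < c" "m0 \<noteq> 0" "0 < \<eta>" "0 < B"
  obtains \<delta> N0 where "0 < \<delta>"
    "\<And>N s m g g0. N0 \<le> N \<Longrightarrow> \<bar>s - c\<bar> \<le> \<delta> \<Longrightarrow> \<bar>m - m0\<bar> \<le> \<delta> \<Longrightarrow> \<bar>g - g0\<bar> \<le> \<delta> \<Longrightarrow> \<bar>g0\<bar> \<le> B \<Longrightarrow>
      s \<noteq> 0 \<and> m \<noteq> 0 \<and> 0 < 1 + g / (N * m) \<and>
      \<bar>- (N * ln (1 + g / (N * m)) / \<bar>s\<bar> powr q) - (- g0 / (c powr q * m0))\<bar> \<le> \<eta>"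
proof -
  define W where "W s m = 1 / (\<bar>s\<bar> powr q * m)" for s m :: real
  define W0 where "W0 = W c m0"
  define e1 where "e1 = min 1 (\<eta> / (3 * B))"
  have e1: "0 < e1" using assms by (simp add: e1_def)
  have "isCont (\<lambda>z. W (fst z) (snd z)) (c, m0)"
    unfolding W_def using assms by (intro continuous_intros) auto
  then have "\<exists>d>0. \<forall>z. dist z (c, m0) < d \<longrightarrow> dist (W (fst z) (snd z)) W0 < e1"
    using e1 unfolding continuous_at_eps_delta W0_def by simp
  then obtain d where d: "0 < d" "\<And>z. dist z (c, m0) < d \<Longrightarrow> dist (W (fst z) (snd z)) W0 < e1"
    by blast
  \<comment> \<open>In this order: continuity of \<open>W\<close>, positivity of \<open>s\<close>,
    \<open>m\<close> bounded away from 0, \<open>|g| \<le> B + 1\<close>, and the error from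
    \<open>g - g0\<close>.\<close>
  define \<delta> where "\<delta> = min (min (d / 3) (c / 2)) (min (\<bar>m0\<bar> / 2) (min 1 (\<eta> / (3 * (\<bar>W0\<bar> + 1)))))"
  have \<delta>: "0 < \<delta>" using assms d by (simp add: \<delta>_def)
  \<comment> \<open>The second entry forces \<open>|u| \<le> 1/2\<close>, where the quadratic bound
    for \<open>ln\<close> holds; the third makes that remainder at most
    \<open>\<eta> / 3\<close>.\<close>
  define N0 where "N0 = max 1 (max (4 * (B + 1) / \<bar>m0\<bar>) (12 * (\<bar>W0\<bar> + 1) * (B + 1)\<^sup>2 / (\<bar>m0\<bar> * \<eta>)))"
  show ?thesis
  proof (rule that[OF \<delta>])
    fix N s m g g0 :: real
    assume N: "N0 \<le> N" and s: "\<bar>s - c\<bar> \<le> \<delta>" and m: "\<bar>m - m0\<bar> \<le> \<delta>" and g: "\<bar>g - g0\<bar> \<le> \<delta>" and g0: "\<bar>g0\<bar> \<le> B"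
    have "\<delta> \<le> c / 2" unfolding \<delta>_def by linarith
    then have s0: "0 < s" using s assms by linarith
    have "\<delta> \<le> \<bar>m0\<bar> / 2" unfolding \<delta>_def by linarith
    then have mh: "\<bar>m0\<bar> / 2 \<le> \<bar>m\<bar>" using m by linarith
    then have mnz: "m \<noteq> 0" using assms by auto
    have "\<delta> \<le> 1" unfolding \<delta>_def by linarith
    then have gB: "\<bar>g\<bar> \<le> B + 1" using g g0 by linarith
    have N1: "1 \<le> N" "4 * (B + 1) / \<bar>m0\<bar> \<le> N" "12 * (\<bar>W0\<bar> + 1) * (B + 1)\<^sup>2 / (\<bar>m0\<bar> * \<eta>) \<le> N"
      using N by (auto simp: N0_def)
    define u where "u = g / (N * m)"
    have "\<bar>u\<bar> = \<bar>g\<bar> / (N * \<bar>m\<bar>)" using N1 by (simp add: u_def abs_mult)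
    also have "\<dots> \<le> (B + 1) / (N * (\<bar>m0\<bar> / 2))"
      using gB mh N1 assms by (intro frac_le mult_left_mono) auto
    also have "\<dots> \<le> 1 / 2" using N1 assms by (simp add: field_simps)
    finally have u: "\<bar>u\<bar> \<le> 1 / 2" .
    have "dist (s, m) (c, m0) \<le> \<bar>s - c\<bar> + \<bar>m - m0\<bar>"
      unfolding dist_Pair_Pair dist_real_def by (rule sqrt_sum_squares_le_sum_abs[THEN order_trans]) simp
    also have "\<dots> \<le> d / 3 + d / 3" using s m by (simp add: \<delta>_def)
    also have "\<dots> < d" using d by simp
    finally have dW: "\<bar>W s m - W0\<bar> \<le> e1" using d(2)[of "(s, m)"] by (simp add: dist_real_def)
    moreover have "e1 \<le> 1" by (simp add: e1_def)
    ultimately have Wb: "\<bar>W s m\<bar> \<le> \<bar>W0\<bar> + 1" by linarith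
    have l: "\<bar>ln (1 + u) - u\<bar> \<le> 2 * u\<^sup>2" by (rule abs_ln_one_plus_x_minus_x_bound[OF u])
    have Nu: "N * m * u = g" using N1 mnz by (simp add: u_def)
    have WL: "W s m * (N * m * ln (1 + u)) = N * ln (1 + u) / \<bar>s\<bar> powr q"
      using mnz by (simp add: W_def)
    have W0g: "W0 * g0 = g0 / (c powr q * m0)" using assms by (simp add: W_def W0_def)
    have eq: "- (N * ln (1 + u) / \<bar>s\<bar> powr q) - (- g0 / (c powr q * m0))
        = - (W s m * (N * m * (ln (1 + u) - u))) - W s m * (g - g0) - (W s m - W0) * g0"
      unfolding WL[symmetric] minus_divide_left[symmetric] W0g[symmetric] Nu[symmetric]
      by (simp only: algebra_simps)
    have "\<bar>W s m * (N * m * (ln (1 + u) - u))\<bar> \<le> (\<bar>W0\<bar> + 1) * (N * \<bar>m\<bar> * (2 * u\<^sup>2))"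
      unfolding abs_mult using Wb l N1 by (intro mult_mono) auto
    also have "N * \<bar>m\<bar> * (2 * u\<^sup>2) = 2 * g\<^sup>2 / (N * \<bar>m\<bar>)"
    proof -
      have "m\<^sup>2 = \<bar>m\<bar> * \<bar>m\<bar>" by (simp add: power2_eq_square)
      then have "u\<^sup>2 = g\<^sup>2 / ((N * \<bar>m\<bar>) * (N * \<bar>m\<bar>))"
        by (simp add: u_def power_divide power_mult_distrib power2_eq_square)
      moreover have "N * \<bar>m\<bar> \<noteq> 0" using N1 mnz by simp
      ultimately show ?thesis by simp
    qed
    also have "(\<bar>W0\<bar> + 1) * (2 * g\<^sup>2 / (N * \<bar>m\<bar>)) \<le> (\<bar>W0\<bar> + 1) * (2 * (B + 1)\<^sup>2 / (N * (\<bar>m0\<bar> / 2)))"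
    proof -
      have "g\<^sup>2 \<le> (B + 1)\<^sup>2" using power_mono[OF gB, of 2] by simp
      then show ?thesis using mh N1 assms by (intro mult_left_mono frac_le) auto
    qed
    also have "\<dots> \<le> \<eta> / 3" using N1 assms by (simp add: field_simps)
    finally have 1: "\<bar>W s m * (N * m * (ln (1 + u) - u))\<bar> \<le> \<eta> / 3" .
    have "\<bar>W s m * (g - g0)\<bar> \<le> (\<bar>W0\<bar> + 1) * (\<eta> / (3 * (\<bar>W0\<bar> + 1)))"
      unfolding abs_mult using Wb g by (intro mult_mono) (auto simp: \<delta>_def)
    also have "\<dots> = \<eta> / 3" by (simp add: field_simps)
    finally have 2: "\<bar>W s m * (g - g0)\<bar> \<le> \<eta> / 3" .
    have "\<bar>(W s m - W0) * g0\<bar> \<le> (\<eta> / (3 * B)) * B"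
      unfolding abs_mult using dW g0 assms by (intro mult_mono) (auto simp: e1_def)
    also have "\<dots> = \<eta> / 3" using assms by simp
    finally have 3: "\<bar>(W s m - W0) * g0\<bar> \<le> \<eta> / 3" .
    have "\<bar>- (N * ln (1 + u) / \<bar>s\<bar> powr q) - (- g0 / (c powr q * m0))\<bar> \<le> \<eta>"
      unfolding eq using 1 2 3 by linarith
    moreover have "0 < 1 + u" using u by linarith
    ultimately show "s \<noteq> 0 \<and> m \<noteq> 0 \<and> 0 < 1 + g / (N * m) \<and>
      \<bar>- (N * ln (1 + g / (N * m)) / \<bar>s\<bar> powr q) - (- g0 / (c powr q * m0))\<bar> \<le> \<eta>"
      using s0 mnz unfolding u_def by simp
  qed
qed

text \<open>The Gaussian target itself moves with \<open>k\<close>, through the variance; the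
  explicit error of the central limit theorem and the convergence of this target are
  combined.\<close>

lemma char_G_tendsto:
  fixes M :: "nat \<Rightarrow> 'w measure" and c K \<alpha> :: real
  assumes sample: "eventually (\<lambda>k. cosine_sample (M k) (n k) (Z k) (m k) K \<alpha>) sequentially"
    and n: "filterlim n at_top sequentially"
    and m: "(\<lambda>k. m k c) \<longlonglongrightarrow> m1" "(\<lambda>k. m k (2 * c)) \<longlonglongrightarrow> m2"
  shows "(\<lambda>k. char (distr (M k) borel (cosine_sample.G (n k) (Z k) (m k) c)) u)
    \<longlonglongrightarrow> complex_of_real (exp (- u\<^sup>2 * ((1 + m2) / 2 - m1\<^sup>2) / 2))"
proof -
  let ?ch = "\<lambda>k. char (distr (M k) borel (cosine_sample.G (n k) (Z k) (m k) c)) u"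
  let ?e = "\<lambda>k. complex_of_real (exp (- u\<^sup>2 * ((1 + m k (2 * c)) / 2 - (m k c)\<^sup>2) / 2))"
  have n': "filterlim (\<lambda>k. real (n k)) at_top sequentially"
    by (rule filterlim_compose[OF filterlim_real_sequentially n])
  have "(\<lambda>k. ?ch k - ?e k) \<longlonglongrightarrow> 0"
  proof (rule Lim_null_comparison)
    show "eventually (\<lambda>k. norm (?ch k - ?e k) \<le> 4 / 3 * \<bar>u\<bar> ^ 3 / sqrt (n k) + u ^ 4 / 8 / n k) sequentially"
      using sample by eventually_elim (use cosine_sample.char_G_bound in fastforce)
    have "(\<lambda>k. 4 / 3 * \<bar>u\<bar> ^ 3 / sqrt (n k) + u ^ 4 / 8 / n k) \<longlonglongrightarrow> 0 + 0"
      by (intro tendsto_add tendsto_divide_0[OF tendsto_const] filterlim_at_top_imp_at_infinity n'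
          filterlim_compose[OF sqrt_at_top n'])
    then show "(\<lambda>k. 4 / 3 * \<bar>u\<bar> ^ 3 / sqrt (n k) + u ^ 4 / 8 / n k) \<longlonglongrightarrow> 0" by simp
  qed
  moreover have "?e \<longlonglongrightarrow> complex_of_real (exp (- u\<^sup>2 * ((1 + m2) / 2 - m1\<^sup>2) / 2))"
    by (intro tendsto_intros m) auto
  ultimately have "(\<lambda>k. (?ch k - ?e k) + ?e k) \<longlonglongrightarrow> 0 + complex_of_real (exp (- u\<^sup>2 * ((1 + m2) / 2 - m1\<^sup>2) / 2))"
    by (rule tendsto_add)
  then show ?thesis by simp
qed

text \<open>One exceptional event collects failure of equicontinuity, of consistency and of
  tightness at \<open>c\<close>, each of probability at most \<open>e / 4\<close>. Off it everything
  is deterministic, so \<open>S\<close> may depend on the sample in any way. The condition on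
  \<open>m\<close> is uniform near \<open>c\<close> because \<open>m\<close> is evaluated at the
  random point.\<close>

lemma log_ratio_linearization:
  fixes M :: "nat \<Rightarrow> 'w measure" and n :: "nat \<Rightarrow> nat" and Z m and c q m0 K \<alpha> e :: real and S :: "nat \<Rightarrow> 'w \<Rightarrow> real"
  defines "H \<equiv> \<lambda>k. cosine_sample.G (n k) (Z k) (m k)"
  assumes sample: "eventually (\<lambda>k. cosine_sample (M k) (n k) (Z k) (m k) K \<alpha>) sequentially"
    and n: "filterlim n at_top sequentially"
    and \<alpha>: "0 < \<alpha>" "\<alpha> \<le> 1"
    and c: "0 < c" "m0 \<noteq> 0"
    and m: "\<And>d. 0 < d \<Longrightarrow> \<exists>\<delta>>0. eventually (\<lambda>k. \<forall>s. \<bar>s - c\<bar> < \<delta> \<longrightarrow> \<bar>m k s - m0\<bar> \<le> d) sequentially"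
    and S[measurable]: "\<And>k. S k \<in> borel_measurable (M k)"
    and consistent: "\<And>d. 0 < d \<Longrightarrow> (\<lambda>k. measure (M k) {\<omega> \<in> space (M k). \<bar>S k \<omega> - c\<bar> > d}) \<longlonglongrightarrow> 0"
    and e: "0 < e"
  shows "eventually (\<lambda>k. \<exists>E\<in>sets (M k). measure (M k) E \<le> e \<and> (\<forall>\<omega>\<in>space (M k) - E.
      S k \<omega> \<noteq> 0 \<and> m k (S k \<omega>) \<noteq> 0 \<and> 0 < 1 + H k (S k \<omega>) \<omega> / (sqrt (n k) * m k (S k \<omega>)) \<and>
      \<bar>- (sqrt (n k) * ln (1 + H k (S k \<omega>) \<omega> / (sqrt (n k) * m k (S k \<omega>))) / \<bar>S k \<omega>\<bar> powr q)
        - (- H k c \<omega> / (c powr q * m0))\<bar> \<le> e)) sequentially"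
proof -
  define B where "B = 2 / sqrt e"
  have B: "0 < B" "1 / B\<^sup>2 = e / 4" using e by (simp_all add: B_def power_divide)
  obtain \<delta> N0 where \<delta>: "0 < \<delta>" and expand:
    "\<And>N s m g g0. N0 \<le> N \<Longrightarrow> \<bar>s - c\<bar> \<le> \<delta> \<Longrightarrow> \<bar>m - m0\<bar> \<le> \<delta> \<Longrightarrow> \<bar>g - g0\<bar> \<le> \<delta> \<Longrightarrow> \<bar>g0\<bar> \<le> B \<Longrightarrow>
      s \<noteq> 0 \<and> m \<noteq> 0 \<and> 0 < 1 + g / (N * m) \<and>
      \<bar>- (N * ln (1 + g / (N * m)) / \<bar>s\<bar> powr q) - (- g0 / (c powr q * m0))\<bar> \<le> e"
    by (rule log_expansion[OF c e B(1), of q]) (rule that, assumption+)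
  define \<eta> where "\<eta> = min \<delta> (e / 4)"
  have \<eta>: "0 < \<eta>" using \<delta> e by (simp add: \<eta>_def)
  obtain \<delta>1 N1 where \<delta>1: "0 < \<delta>1" and equi: "\<forall>n\<ge>N1. \<forall>(M :: 'w measure) Z m. cosine_sample M n Z m K \<alpha> \<longrightarrow>
    (\<exists>E\<in>sets M. measure M E \<le> \<eta> \<and> (\<forall>\<omega>\<in>space M - E. \<forall>s. \<bar>s - c\<bar> < \<delta>1 \<longrightarrow>
       \<bar>cosine_sample.G n Z m s \<omega> - cosine_sample.G n Z m c \<omega>\<bar> \<le> \<eta>))"
    using equicontinuity[OF \<eta> \<alpha>, of K c] by (elim exE conjE) (rule that)
  obtain \<delta>2 where \<delta>2: "0 < \<delta>2" "eventually (\<lambda>k. \<forall>s. \<bar>s - c\<bar> < \<delta>2 \<longrightarrow> \<bar>m k s - m0\<bar> \<le> \<delta>) sequentially"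
    using m[OF \<delta>] by auto
  \<comment> \<open>Halving turns the weak bound \<open>|S - c| \<le> d\<close> into the strict
    inequalities required by the other radii.\<close>
  define d where "d = min \<delta> (min \<delta>1 \<delta>2) / 2"
  have d: "0 < d" "d < \<delta>" "d < \<delta>1" "d < \<delta>2" using \<delta> \<delta>1 \<delta>2 by (auto simp: d_def)
  have "eventually (\<lambda>k. measure (M k) {\<omega> \<in> space (M k). \<bar>S k \<omega> - c\<bar> > d} < e / 4) sequentially"
    using e by (intro order_tendstoD[OF consistent[OF d(1)]]) auto
  moreover have "eventually (\<lambda>k. N1 \<le> n k) sequentially"
    using n by (simp add: filterlim_at_top)
  moreover have "eventually (\<lambda>k. N0 \<le> sqrt (n k)) sequentially"
    using filterlim_compose[OF sqrt_at_top filterlim_compose[OF filterlim_real_sequentially n]]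
    by (simp add: filterlim_at_top)
  ultimately show ?thesis using sample \<delta>2(2)
  proof eventually_elim
    case (elim k)
    interpret cosine_sample "M k" "n k" "Z k" "m k" K \<alpha> by fact
    obtain E where E[measurable]: "E \<in> events" and pE: "prob E \<le> \<eta>"
      and equi_E: "\<And>\<omega> s. \<omega> \<in> space (M k) - E \<Longrightarrow> \<bar>s - c\<bar> < \<delta>1 \<Longrightarrow> \<bar>H k s \<omega> - H k c \<omega>\<bar> \<le> \<eta>"
      using equi[rule_format, OF elim(2,4)] unfolding H_def by (elim bexE conjE) (rule that, auto simp: H_def)
    let ?E1 = "{\<omega> \<in> space (M k). \<bar>S k \<omega> - c\<bar> > d}"
    let ?E2 = "{\<omega> \<in> space (M k). \<bar>H k c \<omega>\<bar> > B}"
    have [measurable]: "H k c \<in> borel_measurable (M k)" unfolding H_def by measurable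
    show ?case
    proof (intro bexI[of _ "E \<union> (?E1 \<union> ?E2)"] conjI ballI)
      have "prob (E \<union> (?E1 \<union> ?E2)) \<le> prob E + (prob ?E1 + prob ?E2)"
        by (intro order_trans[OF measure_Un_le] add_left_mono measure_Un_le) measurable
      moreover have "prob ?E2 \<le> e / 4" using prob_G_gt[OF B(1)] B(2) unfolding H_def by simp
      ultimately show "prob (E \<union> (?E1 \<union> ?E2)) \<le> e" using pE elim(1) e by (simp add: \<eta>_def)
      fix \<omega> assume \<omega>: "\<omega> \<in> space (M k) - (E \<union> (?E1 \<union> ?E2))"
      then have Sc: "\<bar>S k \<omega> - c\<bar> \<le> d" and GB: "\<bar>H k c \<omega>\<bar> \<le> B" by auto
      have "\<bar>m k (S k \<omega>) - m0\<bar> \<le> \<delta>" using elim(5) Sc d by auto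
      moreover have "\<bar>H k (S k \<omega>) \<omega> - H k c \<omega>\<bar> \<le> \<delta>"
        using equi_E[of \<omega> "S k \<omega>"] \<omega> Sc d by (auto simp: \<eta>_def)
      ultimately have ex: "S k \<omega> \<noteq> 0 \<and> m k (S k \<omega>) \<noteq> 0 \<and> 0 < 1 + H k (S k \<omega>) \<omega> / (sqrt (n k) * m k (S k \<omega>)) \<and>
      \<bar>- (sqrt (n k) * ln (1 + H k (S k \<omega>) \<omega> / (sqrt (n k) * m k (S k \<omega>))) / \<bar>S k \<omega>\<bar> powr q)
        - (- H k c \<omega> / (c powr q * m0))\<bar> \<le> e"
        using elim(3) Sc GB d by (intro expand) auto
      then show "S k \<omega> \<noteq> 0" "m k (S k \<omega>) \<noteq> 0" "0 < 1 + H k (S k \<omega>) \<omega> / (sqrt (n k) * m k (S k \<omega>))"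
        "\<bar>- (sqrt (n k) * ln (1 + H k (S k \<omega>) \<omega> / (sqrt (n k) * m k (S k \<omega>))) / \<bar>S k \<omega>\<bar> powr q)
        - (- H k c \<omega> / (c powr q * m0))\<bar> \<le> e" by blast+
    qed measurable
  qed
qed

section \<open>The linear measurement model\<close>

lemma char_scale:
  assumes [measurable]: "X \<in> borel_measurable M"
  shows "char (distr M borel (\<lambda>\<omega>. c * X \<omega>)) t = char (distr M borel X) (t * c)"
  by (simp add: char_def integral_distr mult.assoc)

lemma (in prob_space) expectation_cos_eq_Re_char:
  assumes [measurable]: "X \<in> borel_measurable M"
  shows "expectation (\<lambda>\<omega>. cos (t * X \<omega>)) = Re (char (distr M borel X) t)"
proof -
  have "Re (char (distr M borel X) t) = Re (CLINT \<omega>|M. iexp (t * X \<omega>))"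
    by (simp add: char_def integral_distr)
  also have "\<dots> = expectation (\<lambda>\<omega>. Re (iexp (t * X \<omega>)))"
    by (intro integral_Re[symmetric] integrable_iexp) auto
  also have "\<dots> = expectation (\<lambda>\<omega>. cos (t * X \<omega>))" by (simp add: Re_exp)
  finally show ?thesis ..
qed

text \<open>Observation \<open>i\<close> depends only on the block \<open>J i\<close> made of its
  row of coefficients and its noise. Blocks are disjoint, which gives independence of the
  observations; inside a block the characteristic function factorizes.\<close>

lemma (in prob_space)
  fixes a :: "nat \<Rightarrow> nat \<Rightarrow> 'a \<Rightarrow> real" and \<epsilon> :: "nat \<Rightarrow> 'a \<Rightarrow> real" and b :: "nat \<Rightarrow> real" and s :: real and n p :: nat
  defines "Z \<equiv> \<lambda>i \<omega>. (\<Sum>j<p. a i j \<omega> * b j) + s * \<epsilon> i \<omega>"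
  assumes indep: "indep_vars (\<lambda>_. borel) (\<lambda>z. case z of Inl (i, j) \<Rightarrow> a i j | Inr i \<Rightarrow> \<epsilon> i)
        (({..<n} \<times> {..<p}) <+> {..<n})"
  shows indep_vars_linear_model: "indep_vars (\<lambda>_. borel) Z {..<n}"
    and char_linear_model: "i < n \<Longrightarrow> char (distr M borel (Z i)) t =
      (\<Prod>j<p. char (distr M borel (a i j)) (t * b j)) * char (distr M borel (\<epsilon> i)) (t * s)"
proof -
  let ?X = "\<lambda>z. case z of Inl (i, j) \<Rightarrow> a i j | Inr i \<Rightarrow> \<epsilon> i"
  let ?I = "({..<n} \<times> {..<p}) <+> {..<n}"
  define J where "J i = ({i} \<times> {..<p}) <+> {i}" for i :: nat
  have J: "J i \<subseteq> ?I" if "i < n" for i using that by (auto simp: J_def)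
  have rv: "?X z \<in> borel_measurable M" if "z \<in> ?I" for z
    using indep that unfolding indep_vars_def2 by blast
  have Pair_image: "{i} \<times> {..<p} = Pair i ` {..<p}" for i :: nat by auto
  have "disjoint_family_on J {..<n}" by (auto simp: disjoint_family_on_def J_def)
  then have "indep_vars (\<lambda>i. PiM (J i) (\<lambda>_. borel)) (\<lambda>i \<omega>. restrict (\<lambda>z. ?X z \<omega>) (J i)) {..<n}"
    using J by (intro indep_vars_restrict[OF indep]) auto
  then have "indep_vars (\<lambda>_. borel)
      (\<lambda>i \<omega>. (\<lambda>i f. (\<Sum>j<p. f (Inl (i, j)) * b j) + s * f (Inr i)) i (restrict (\<lambda>z. ?X z \<omega>) (J i))) {..<n}"
  proof (rule indep_vars_compose2)
    fix i assume "i \<in> {..<n}"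
    show "(\<lambda>f. (\<Sum>j<p. f (Inl (i, j)) * b j) + s * f (Inr i)) \<in> PiM (J i) (\<lambda>_. borel) \<rightarrow>\<^sub>M borel"
      by (intro borel_measurable_add borel_measurable_sum borel_measurable_times borel_measurable_const
          measurable_component_singleton) (auto simp: J_def)
  qed
  also have "(\<lambda>i \<omega>. (\<lambda>i f. (\<Sum>j<p. f (Inl (i, j)) * b j) + s * f (Inr i)) i (restrict (\<lambda>z. ?X z \<omega>) (J i))) = Z"
    by (auto simp: Z_def J_def fun_eq_iff intro!: sum.cong)
  finally show "indep_vars (\<lambda>_. borel) Z {..<n}" .
  assume i: "i < n"
  let ?c = "\<lambda>z. case z of Inl (i, j) \<Rightarrow> b j | Inr i \<Rightarrow> s"
  have ind: "indep_vars (\<lambda>_. borel) (\<lambda>z \<omega>. ?c z * ?X z \<omega>) (J i)"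
    by (rule indep_vars_compose2[OF indep_vars_subset[OF indep J[OF i]]]) auto
  have "Z i = (\<lambda>\<omega>. \<Sum>z\<in>J i. ?c z * ?X z \<omega>)"
    by (simp add: Z_def J_def sum.Plus Pair_image sum.reindex inj_on_def fun_eq_iff mult.commute)
  then have "char (distr M borel (Z i)) t = (\<Prod>z\<in>J i. char (distr M borel (\<lambda>\<omega>. ?c z * ?X z \<omega>)) t)"
    using char_distr_sum[OF ind] by simp
  also have "\<dots> = (\<Prod>z\<in>J i. char (distr M borel (?X z)) (t * ?c z))"
    using J[OF i] rv by (intro prod.cong refl char_scale) blast
  also have "\<dots> = (\<Prod>j<p. char (distr M borel (a i j)) (t * b j)) * char (distr M borel (\<epsilon> i)) (t * s)"
    by (simp add: J_def prod.Plus Pair_image prod.reindex inj_on_def)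
  finally show "char (distr M borel (Z i)) t =
      (\<Prod>j<p. char (distr M borel (a i j)) (t * b j)) * char (distr M borel (\<epsilon> i)) (t * s)" .
qed

text \<open>With only a first moment, \<open>1 - cos v \<le> |v|\<close> takes the place of the
  quadratic bound; this caps the increment exponent at 1.\<close>

lemma (in real_distribution) one_minus_Re_char_le:
  assumes "integrable M (\<lambda>x. \<bar>x\<bar>)"
  shows "1 - Re (char M u) \<le> \<bar>u\<bar> * expectation (\<lambda>x. \<bar>x\<bar>)"
proof -
  have int: "integrable M (\<lambda>x. cos (u * x))" by (intro integrable_const_bound[of _ 1]) auto
  have "distr M borel (\<lambda>x. x) = M" by (rule distr_id2) simp
  then have "1 - Re (char M u) = 1 - expectation (\<lambda>x. cos (u * x))"
    using expectation_cos_eq_Re_char[of "\<lambda>x. x" u] by simp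
  also have "\<dots> = expectation (\<lambda>x. 1 - cos (u * x))"
    using int prob_space by (simp del: space_eq_univ)
  also have "\<dots> \<le> expectation (\<lambda>x. \<bar>u\<bar> * \<bar>x\<bar>)"
  proof (rule integral_mono)
    show "1 - cos (u * x) \<le> \<bar>u\<bar> * \<bar>x\<bar>" for x
      using abs_cos_diff_le[of 0 "u * x"] by (simp add: abs_mult abs_le_iff)
  qed (use int assms in auto)
  finally show ?thesis by simp
qed

lemma (in real_distribution) abs_Re_char_le_1: "\<bar>Re (char M u)\<bar> \<le> 1"
  using abs_Re_le_cmod cmod_char_le_1 order_trans by blast

text \<open>Jensen's inequality for \<open>cos (u x)\<close> combined with the double angle formula.
  It keeps the limiting variance away from 0.\<close>

lemma (in real_distribution) Re_char_double: "2 * (Re (char M u))\<^sup>2 - 1 \<le> Re (char M (2 * u))"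
proof -
  have id: "distr M borel (\<lambda>x. x) = M" by (rule distr_id2) simp
  have E: "Re (char M u) = expectation (\<lambda>x. cos (u * x))" for u
    using expectation_cos_eq_Re_char[of "\<lambda>x. x" u] by (simp add: id)
  have int: "integrable M (\<lambda>x. cos (u * x))" by (intro integrable_const_bound[of _ 1]) auto
  have int2: "integrable M (\<lambda>x. (cos (u * x))\<^sup>2)"
    by (intro integrable_const_bound[of _ 1]) (auto simp: abs_square_le_1)
  have "(expectation (\<lambda>x. cos (u * x)))\<^sup>2 \<le> expectation (\<lambda>x. (cos (u * x))\<^sup>2)"
    using variance_eq[OF int int2] variance_positive[of "\<lambda>x. cos (u * x)"] by linarith
  moreover have "expectation (\<lambda>x. cos (2 * u * x)) = 2 * expectation (\<lambda>x. (cos (u * x))\<^sup>2) - 1"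
  proof -
    have "cos (2 * u * x) = 2 * (cos (u * x))\<^sup>2 - 1" for x
      using cos_double_cos[of "u * x"] by (simp add: mult.assoc)
    then show ?thesis using int2 prob_space by (simp del: space_eq_univ)
  qed
  ultimately show ?thesis unfolding E by simp
qed

text \<open>For \<open>|h| \<le> 1\<close> the two factors contribute \<open>|h|^q\<close> and
  \<open>R A |h|\<close>, and the smaller exponent dominates. For larger \<open>h\<close> the left
  side is at most 2, whence the constant \<open>2 + R * A\<close>.\<close>

lemma one_minus_exp_powr_mult_le:
  fixes f :: "real \<Rightarrow> real"
  assumes q: "0 < q" and "0 \<le> A" "0 \<le> \<rho>" "\<rho> \<le> R"
    and f: "\<And>u. \<bar>f u\<bar> \<le> 1" "\<And>u. 1 - f u \<le> \<bar>u\<bar> * A"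
  shows "1 - exp (- (\<bar>h\<bar> powr q)) * f (\<rho> * h) \<le> (2 + R * A) * \<bar>h\<bar> powr (min q 1)"
proof -
  define E where "E = exp (- (\<bar>h\<bar> powr q))"
  have E: "0 < E" "E \<le> 1" "1 - E \<le> \<bar>h\<bar> powr q"
    using exp_ge_add_one_self[of "- (\<bar>h\<bar> powr q)"] by (auto simp: E_def)
  have RA: "0 \<le> R * A" using assms by simp
  show ?thesis
  proof (cases "\<bar>h\<bar> \<le> 1")
    case True
    have a: "\<bar>h\<bar> powr q \<le> \<bar>h\<bar> powr (min q 1)" using True by (intro powr_mono') auto
    have b: "\<bar>h\<bar> \<le> \<bar>h\<bar> powr (min q 1)" using True powr_mono'[of "min q 1" 1 "\<bar>h\<bar>"] by simp
    have "1 - E * f (\<rho> * h) = (1 - E) + E * (1 - f (\<rho> * h))" by (simp add: algebra_simps)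
    also have "\<dots> \<le> (1 - E) + 1 * (1 - f (\<rho> * h))"
      using E f(1)[of "\<rho> * h"] by (intro add_left_mono mult_right_mono) (auto simp: abs_le_iff)
    also have "\<dots> \<le> \<bar>h\<bar> powr q + \<bar>\<rho> * h\<bar> * A" unfolding mult_1 by (intro add_mono E(3) f(2))
    also have "\<bar>\<rho> * h\<bar> * A \<le> (R * A) * \<bar>h\<bar>"
      using assms mult_right_mono[of "\<rho>" R "\<bar>h\<bar> * A"] by (simp add: abs_mult mult_ac)
    also have "\<bar>h\<bar> powr q + (R * A) * \<bar>h\<bar> \<le> \<bar>h\<bar> powr (min q 1) + (R * A) * \<bar>h\<bar> powr (min q 1)"
      using a b RA by (intro add_mono mult_left_mono) auto
    also have "\<dots> \<le> (2 + R * A) * \<bar>h\<bar> powr (min q 1)" by (simp add: algebra_simps)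
    finally show ?thesis by (simp add: E_def)
  next
    case False
    have "\<bar>E * f (\<rho> * h)\<bar> \<le> 1 * 1" unfolding abs_mult using E f(1) by (intro mult_mono) auto
    then have "1 - E * f (\<rho> * h) \<le> 2" by (simp add: abs_le_iff)
    also have "\<dots> \<le> (2 + R * A) * 1" using RA by simp
    also have "\<dots> \<le> (2 + R * A) * \<bar>h\<bar> powr (min q 1)"
      using False q RA by (intro mult_left_mono ge_one_powr_ge_zero) auto
    finally show ?thesis by (simp add: E_def)
  qed
qed

text \<open>By stability the inner product with \<open>x\<close> has scale \<open>L\<close>, so
  division by \<open>L\<close> leaves the universal factor \<open>exp (- |t|^q)\<close>, and
  \<open>x\<close>, \<open>\<sigma>\<close> and \<open>\<gamma>\<close> survive only in
  \<open>\<sigma> / L\<close>. The constant depends on that ratio only through its bound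
  \<open>R\<close>.\<close>

lemma cosine_sample_linear_model:
  fixes a :: "nat \<Rightarrow> nat \<Rightarrow> 'a \<Rightarrow> real" and \<epsilon> :: "nat \<Rightarrow> 'a \<Rightarrow> real" and x :: "nat \<Rightarrow> real" and n p :: nat
  assumes "prob_space M" and q: "0 < q" and n: "0 < n" and L: "0 < L"
    and "0 < \<sigma>" "\<sigma> / L \<le> R"
    and F0: "real_distribution F0" "integrable F0 (\<lambda>e. \<bar>e\<bar>)"
    and indep: "prob_space.indep_vars M (\<lambda>_. borel)
        (\<lambda>z. case z of Inl (i, j) \<Rightarrow> a i j | Inr i \<Rightarrow> \<epsilon> i) (({..<n} \<times> {..<p}) <+> {..<n})"
    and a_law: "\<And>i j. i < n \<Longrightarrow> j < p \<Longrightarrow> stable_law q \<gamma> (distr M borel (a i j))"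
    and \<epsilon>_law: "\<And>i. i < n \<Longrightarrow> distr M borel (\<epsilon> i) = F0"
    and L_powr: "(\<Sum>j<p. \<bar>\<gamma> * x j\<bar> powr q) = L powr q"
  shows "cosine_sample M n (\<lambda>i \<omega>. ((\<Sum>j<p. a i j \<omega> * x j) + \<sigma> * \<epsilon> i \<omega>) / L)
      (\<lambda>t. exp (- (\<bar>t\<bar> powr q)) * Re (char F0 (\<sigma> / L * t)))
      (2 + R * (\<integral>e. \<bar>e\<bar> \<partial>F0)) (min q 1)"
proof -
  interpret prob_space M by fact
  interpret F0: real_distribution F0 by fact
  let ?Z = "\<lambda>i \<omega>. ((\<Sum>j<p. a i j \<omega> * x j) + \<sigma> * \<epsilon> i \<omega>) / L"
  have Z: "?Z = (\<lambda>i \<omega>. (\<Sum>j<p. a i j \<omega> * (x j / L)) + (\<sigma> / L) * \<epsilon> i \<omega>)"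
    by (simp add: add_divide_distrib sum_divide_distrib)
  note indep_Z = indep_vars_linear_model[OF indep, of "\<lambda>j. x j / L" "\<sigma> / L", folded Z]
  show ?thesis
  proof
    show "0 < n" "0 < min q 1" "min q 1 \<le> 1" using n q by auto
    show "indep_vars (\<lambda>_. borel) ?Z {..<n}" by (rule indep_Z)
    show "1 - exp (- (\<bar>h\<bar> powr q)) * Re (char F0 (\<sigma> / L * h)) \<le> (2 + R * (\<integral>e. \<bar>e\<bar> \<partial>F0)) * \<bar>h\<bar> powr (min q 1)" for h
      using assms F0.abs_Re_char_le_1 F0.one_minus_Re_char_le[OF F0(2)]
      by (intro one_minus_exp_powr_mult_le) auto
    fix i t assume i: "i < n"
    have "char (distr M borel (?Z i)) t
        = (\<Prod>j<p. char (distr M borel (a i j)) (t * (x j / L))) * char (distr M borel (\<epsilon> i)) (t * (\<sigma> / L))"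
      using char_linear_model[OF indep i, of "\<lambda>j. x j / L" "\<sigma> / L" t]
      by (simp only: fun_cong[OF Z, of i])
    also have "(\<Prod>j<p. char (distr M borel (a i j)) (t * (x j / L)))
        = complex_of_real (exp (- (\<Sum>j<p. \<bar>\<gamma> * (t * (x j / L))\<bar> powr q)))"
      using a_law[OF i] by (simp add: stable_law_def exp_sum sum_negf[symmetric])
    also have "(\<Sum>j<p. \<bar>\<gamma> * (t * (x j / L))\<bar> powr q) = (\<bar>t\<bar> / L) powr q * (\<Sum>j<p. \<bar>\<gamma> * x j\<bar> powr q)"
      unfolding sum_distrib_left
    proof (rule sum.cong[OF refl])
      fix j
      have "\<bar>\<gamma> * (t * (x j / L))\<bar> = (\<bar>t\<bar> / L) * \<bar>\<gamma> * x j\<bar>" using L by (simp add: abs_mult)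
      then show "\<bar>\<gamma> * (t * (x j / L))\<bar> powr q = (\<bar>t\<bar> / L) powr q * \<bar>\<gamma> * x j\<bar> powr q"
        by (simp only: powr_mult)
    qed
    also have "\<dots> = \<bar>t\<bar> powr q" unfolding L_powr using L by (simp add: powr_divide)
    also have "char (distr M borel (\<epsilon> i)) (t * (\<sigma> / L)) = char F0 (\<sigma> / L * t)"
      using \<epsilon>_law[OF i] by (simp add: mult.commute)
    finally have "char (distr M borel (?Z i)) t = complex_of_real (exp (- (\<bar>t\<bar> powr q))) * char F0 (\<sigma> / L * t)" .
    moreover have "?Z i \<in> borel_measurable M" using indep_Z i by (auto simp: indep_vars_def2)
    ultimately show "expectation (\<lambda>\<omega>. cos (t * ?Z i \<omega>)) = exp (- (\<bar>t\<bar> powr q)) * Re (char F0 (\<sigma> / L * t))"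
      using expectation_cos_eq_Re_char[of "?Z i" t] by simp
  qed
qed

text \<open>The variance is affine in \<open>(\<phi> (\<rho> c))^2\<close>, once \<open>\<phi> (2 \<rho> c)\<close> is bounded below by the double angle
  inequality, so positivity only has to be checked at 0 and 1.\<close>

lemma v_q_pos:
  assumes "0 < q" "q \<le> 2" "0 < c" and nz: "\<phi> (\<rho> * c) \<noteq> 0"
    and \<phi>: "\<bar>\<phi> (\<rho> * c)\<bar> \<le> 1" "2 * (\<phi> (\<rho> * c))\<^sup>2 - 1 \<le> \<phi> (2 * (\<rho> * c))"
  shows "0 < v_q q \<phi> c \<rho>"
    and "v_q q \<phi> c \<rho> = ((1 + exp (- ((2 * c) powr q)) * \<phi> (2 * (\<rho> * c))) / 2 - (exp (- (c powr q)) * \<phi> (\<rho> * c))\<^sup>2)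
       / (c powr q * (exp (- (c powr q)) * \<phi> (\<rho> * c)))\<^sup>2"
proof -
  define w where "w = c powr q"
  define F where "F = \<phi> (\<rho> * c)"
  define F2 where "F2 = \<phi> (2 * (\<rho> * c))"
  define A where "A = exp (- ((2 * c) powr q))"
  define B where "B = (exp (- w))\<^sup>2"
  define \<tau> where "\<tau> = (1 + A * F2) / 2 - B * F\<^sup>2"
  have w: "0 < w" using assms by (simp add: w_def)
  have f: "0 < F\<^sup>2" "F\<^sup>2 \<le> 1" using nz \<phi>(1) by (auto simp: F_def abs_square_le_1)
  have B: "B = exp (- (2 * w))" by (simp add: B_def exp_double[symmetric])
  have A: "A = exp (- (2 powr q * w))" using assms by (simp add: A_def w_def powr_mult)
  have A0: "0 < A" by (simp add: A)
  have B0: "0 < B" by (simp add: B)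
  \<comment> \<open>\<open>q \<le> 2\<close> yields \<open>B^2 \<le> A\<close>, hence
    \<open>1 + A - 2 B \<ge> (1 - B)^2 > 0\<close>: positivity at the endpoint
    \<open>F^2 = 1\<close>.\<close>
  have "2 powr q \<le> (2::real) powr 2" using assms by (intro powr_mono) auto
  then have "2 powr q * w \<le> 4 * w" using w by (intro mult_right_mono) auto
  then have AB: "B\<^sup>2 \<le> A" by (simp add: A B exp_double[symmetric])
  have B1: "B < 1" and A1: "A < 1" using w by (simp_all add: A B)
  have "0 < (1 - B)\<^sup>2" using B1 by simp
  moreover have "(1 - B)\<^sup>2 = 1 - 2 * B + B\<^sup>2" by (simp add: power2_diff)
  ultimately have one: "0 < 1 + A - 2 * B" using AB by linarith
  have F2: "A * (2 * F\<^sup>2 - 1) \<le> A * F2" using \<phi>(2) A0 unfolding F_def F2_def by (intro mult_left_mono) auto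
  \<comment> \<open>The convex combination of the endpoint values, with weights
    \<open>1 - F^2\<close> and \<open>F^2\<close>.\<close>
  have "1 + A * (2 * F\<^sup>2 - 1) - 2 * (B * F\<^sup>2) = (1 - F\<^sup>2) * (1 - A) + F\<^sup>2 * (1 + A - 2 * B)"
    by (simp add: algebra_simps)
  moreover have "0 < F\<^sup>2 * (1 + A - 2 * B)" using f one by (intro mult_pos_pos)
  moreover have "0 \<le> (1 - F\<^sup>2) * (1 - A)" using f A1 by simp
  ultimately have "0 < 1 + A * F2 - 2 * (B * F\<^sup>2)" using F2 by linarith
  then have tau: "0 < \<tau>" by (simp add: \<tau>_def)
  have "v_q q \<phi> c \<rho> = 1 / w\<^sup>2 * (1 / 2 * (1 / F\<^sup>2) * (1 / B) + 1 / 2 * (F2 / F\<^sup>2) * (A / B) - 1)"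
  proof -
    have e: "exp (2 * w) = 1 / B" by (simp add: B exp_minus field_simps)
    have e2: "exp ((2 - 2 powr q) * w) = A / B"
      by (simp add: A B exp_diff[symmetric] algebra_simps)
    have c2: "c powr (2 * q) = w\<^sup>2" using assms by (simp add: w_def power2_eq_square powr_add[symmetric])
    show ?thesis unfolding v_q_def abs_of_pos[OF assms(3)] mult.assoc F_def[symmetric] F2_def[symmetric]
        w_def[symmetric] c2 e e2 by simp
  qed
  also have "\<dots> = \<tau> / (w\<^sup>2 * (B * F\<^sup>2))"
    using w f B0 by (simp add: \<tau>_def field_simps)
  finally have eq: "v_q q \<phi> c \<rho> = \<tau> / (w\<^sup>2 * (B * F\<^sup>2))" .
  show "0 < v_q q \<phi> c \<rho>" unfolding eq using tau w f B0 by simp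
  show "v_q q \<phi> c \<rho> = ((1 + exp (- ((2 * c) powr q)) * \<phi> (2 * (\<rho> * c))) / 2 - (exp (- (c powr q)) * \<phi> (\<rho> * c))\<^sup>2)
       / (c powr q * (exp (- (c powr q)) * \<phi> (\<rho> * c)))\<^sup>2"
    unfolding eq \<tau>_def A_def B_def F_def F2_def w_def power_mult_distrib ..
qed

lemma Re_Psi_hat_div:
  "Re (Psi_hat n y t / complex_of_real r) = (\<Sum>i<n. cos (t * y i)) / n / r"
proof -
  have "Psi_hat n y t = complex_of_real (1 / n) * (\<Sum>i<n. cis (t * y i))"
    by (simp add: Psi_hat_def)
  moreover have "Re (complex_of_real c * z) = c * Re z" for c z by simp
  ultimately have "Re (Psi_hat n y t) = 1 / n * (\<Sum>i<n. cos (t * y i))"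
    by (simp only: Re_sum cis.sel)
  then show ?thesis by simp
qed

text \<open>An identity without error term: \<open>m\<close> carries the factor
  \<open>exp (- |s|^q)\<close>, whose logarithm yields exactly the 1 that is subtracted.
  \<open>C / m > 0\<close> selects the logarithmic branch of \<open>Log_plus\<close> and removes its
  absolute value, even if \<open>\<phi>\<close> is negative.\<close>

lemma nu_hat_eq:
  fixes q \<sigma> \<gamma> l t :: real and n :: nat and y :: "nat \<Rightarrow> real" and \<phi> :: "real \<Rightarrow> real"
  defines "s \<equiv> t * (\<gamma> * l)"
  defines "C \<equiv> (\<Sum>i<n. cos (t * y i)) / n" and "m \<equiv> exp (- (\<bar>s\<bar> powr q)) * \<phi> (\<sigma> * t)"
  assumes "0 < \<gamma>" "0 < l" "t \<noteq> 0" "\<phi> (\<sigma> * t) \<noteq> 0" and pos: "0 < C / m"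
  shows "nu_hat q \<phi> \<sigma> \<gamma> n y t / l powr q - 1 = - (ln (C / m) / \<bar>s\<bar> powr q)"
proof -
  let ?w = "\<bar>s\<bar> powr q"
  have w: "0 < ?w" using assms by (simp add: s_def)
  have sw: "\<gamma> powr q * \<bar>t\<bar> powr q * l powr q = ?w"
    using assms by (simp add: s_def abs_mult powr_mult)
  have ratio: "Re (Psi_hat n y t / complex_of_real (\<phi> (\<sigma> * t))) = C / m * exp (- ?w)"
    unfolding Re_Psi_hat_div using assms by (simp add: C_def m_def)
  have "Log_plus (C / m * exp (- ?w)) = ln (C / m * exp (- ?w))"
  proof -
    have "Log_plus r = ln r" if "0 < r" for r using that by (simp add: Log_plus_def)
    then show ?thesis using mult_pos_pos[OF pos exp_gt_zero] by blast
  qed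
  also have "\<dots> = ln (C / m) + ln (exp (- ?w))" by (rule ln_mult_pos[OF pos exp_gt_zero])
  finally have log: "Log_plus (C / m * exp (- ?w)) = ln (C / m) - ?w" by simp
  have "nu_hat q \<phi> \<sigma> \<gamma> n y t / l powr q
      = - 1 / (\<gamma> powr q * \<bar>t\<bar> powr q) * (ln (C / m) - ?w) / l powr q"
    using assms unfolding nu_hat_def ratio log by simp
  also have "\<dots> = - ((ln (C / m) - ?w) / ?w)" unfolding sw[symmetric] by simp
  also have "\<dots> = 1 - ln (C / m) / ?w" using w by (simp add: diff_divide_distrib)
  finally show ?thesis by simp
qed

text \<open>Identifies the ratio of empirical to true cosine moment, inside the estimator's
  logarithm, with a perturbation of 1 of size \<open>1 / sqrt n\<close>.\<close>

lemma (in cosine_sample) one_plus_G: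
  assumes "m t \<noteq> 0"
  shows "1 + G t \<omega> / (sqrt n * m t) = (\<Sum>i<n. cos (t * Z i \<omega>)) / n / m t"
proof -
  have n0: "0 < real n" using n_pos by simp
  have "G t \<omega> / sqrt n = (\<Sum>i<n. X t i \<omega>) / (sqrt n * sqrt n)" by (simp add: G_def)
  also have "\<dots> = ((\<Sum>i<n. cos (t * Z i \<omega>)) - n * m t) / n"
    by (simp add: X_def sum_subtractf)
  also have "\<dots> = (\<Sum>i<n. cos (t * Z i \<omega>)) / n - m t" using n0 by (simp add: diff_divide_distrib)
  finally have eq: "G t \<omega> / sqrt n = (\<Sum>i<n. cos (t * Z i \<omega>)) / n - m t" .
  have "1 + G t \<omega> / (sqrt n * m t) = 1 + G t \<omega> / sqrt n / m t" by simp
  also have "\<dots> = (\<Sum>i<n. cos (t * Z i \<omega>)) / n / m t"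
    unfolding eq using assms by (simp add: diff_divide_distrib)
  finally show ?thesis .
qed

section \<open>Asymptotic normality\<close>

theorem theorem2:
  fixes q :: real
    and F0 :: "real measure"
    and M :: "nat \<Rightarrow> 'w measure"
    and n p :: "nat \<Rightarrow> nat"
    and x :: "nat \<Rightarrow> nat \<Rightarrow> real"
    and \<sigma> \<gamma> :: "nat \<Rightarrow> real"
    and a :: "nat \<Rightarrow> nat \<Rightarrow> nat \<Rightarrow> 'w \<Rightarrow> real"
    and \<epsilon> :: "nat \<Rightarrow> nat \<Rightarrow> 'w \<Rightarrow> real"
    and T :: "nat \<Rightarrow> (nat \<Rightarrow> real) \<Rightarrow> real"
    and \<rho>bar c0 :: real
    and y :: "nat \<Rightarrow> nat \<Rightarrow> 'w \<Rightarrow> real"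
    and t_hat :: "nat \<Rightarrow> 'w \<Rightarrow> real"
  defines "\<phi>0 \<equiv> (\<lambda>t. Re (char F0 t))"
    and "\<rho> \<equiv> (\<lambda>k. \<sigma> k / (\<gamma> k * lq_norm q (p k) (x k)))"
  assumes q: "0 < q" "q \<le> 2"
    \<comment> \<open>noise law F0: fixed, symmetric, 0 < E|eps| < infinity, real char. function with isolated zeros\<close>
    and F0_distr: "real_distribution F0"
    and F0_symm: "distr F0 borel uminus = F0"
    and F0_int: "integrable F0 (\<lambda>e. \<bar>e\<bar>)"
    and F0_pos: "0 < (\<integral>e. \<bar>e\<bar> \<partial>F0)"
    and F0_char_real: "\<And>t. Im (char F0 t) = 0"
    and F0_zeros: "\<And>t. \<not> t islimpt {s. \<phi>0 s = 0}"
    \<comment> \<open>asymptotic regime along the index k\<close>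
    and n_inf: "filterlim n at_top sequentially"
    and p_inf: "filterlim p at_top sequentially"
    and x_nz: "\<And>k. \<exists>j<p k. x k j \<noteq> 0"
    and \<sigma>_pos: "\<And>k. 0 < \<sigma> k"
    and \<gamma>_pos: "\<And>k. 0 < \<gamma> k"
    \<comment> \<open>measurement model\<close>
    and M_prob: "\<And>k. prob_space (M k)"
    and a_rv: "\<And>k i j. a k i j \<in> borel_measurable (M k)"
    and \<epsilon>_rv: "\<And>k i. \<epsilon> k i \<in> borel_measurable (M k)"
    and indep: "\<And>k. prob_space.indep_vars (M k) (\<lambda>_. borel)
        (\<lambda>z. case z of Inl (i, j) \<Rightarrow> a k i j | Inr i \<Rightarrow> \<epsilon> k i)
        (({..<n k} \<times> {..<p k}) <+> {..<n k})"
    and a_law: "\<And>k i j. i < n k \<Longrightarrow> j < p k \<Longrightarrow> stable_law q (\<gamma> k) (distr (M k) borel (a k i j))"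
    and \<epsilon>_law: "\<And>k i. i < n k \<Longrightarrow> distr (M k) borel (\<epsilon> k i) = F0"
    and y_def: "\<And>k i \<omega>. y k i \<omega> = (\<Sum>j<p k. a k i j \<omega> * x k j) + \<sigma> k * \<epsilon> k i \<omega>"
    \<comment> \<open>assumption (A3)\<close>
    and \<rho>bar_nonneg: "0 \<le> \<rho>bar"
    and A3: "(\<lambda>k. sqrt (real (n k)) * (\<rho> k - \<rho>bar)) \<longlonglongrightarrow> 0"
    \<comment> \<open>t_hat is a (measurable) function of y_1..y_n, consistent for c0 / (gamma ||x||_q)\<close>
    and T_meas: "\<And>k. T k \<in> borel_measurable (PiM {..<n k} (\<lambda>_. borel))"
    and t_hat_def: "\<And>k \<omega>. t_hat k \<omega> = T k (restrict (\<lambda>i. y k i \<omega>) {..<n k})"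
    and c0_pos: "0 < c0"
    and c0_zero: "\<phi>0 (\<rho>bar * c0) \<noteq> 0"
    and t_hat_cons: "\<And>e. 0 < e \<Longrightarrow>
        (\<lambda>k. measure (M k) {\<omega> \<in> space (M k).
           \<bar>t_hat k \<omega> * \<gamma> k * lq_norm q (p k) (x k) - c0\<bar> > e}) \<longlonglongrightarrow> 0"
  shows "0 < v_q q \<phi>0 c0 \<rho>bar \<and>
    weak_conv_m
      (\<lambda>k. distr (M k) borel (\<lambda>\<omega>. sqrt (real (n k)) *
          (nu_hat q \<phi>0 (\<sigma> k) (\<gamma> k) (n k) (\<lambda>i. y k i \<omega>) (t_hat k \<omega>) / lq_norm q (p k) (x k) powr q - 1)))
      (normal_law (v_q q \<phi>0 c0 \<rho>bar))"
proof -
  interpret F0: real_distribution F0 by (rule F0_distr)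
  define l where "l k = lq_norm q (p k) (x k)" for k
  define L where "L k = \<gamma> k * l k" for k
  define Z where "Z k i \<omega> = y k i \<omega> / L k" for k i \<omega>
  define m where "m k s = exp (- (\<bar>s\<bar> powr q)) * \<phi>0 (\<sigma> k / L k * s)" for k s
  define m0 where "m0 = exp (- (c0 powr q)) * \<phi>0 (\<rho>bar * c0)"
  define m2 where "m2 = exp (- ((2 * c0) powr q)) * \<phi>0 (2 * (\<rho>bar * c0))"
  define \<alpha> where "\<alpha> = min q 1"
  define K where "K = 2 + (\<rho>bar + 1) * (\<integral>e. \<bar>e\<bar> \<partial>F0)"
  define S where "S k \<omega> = t_hat k \<omega> * L k" for k \<omega>
  define D where "D k \<omega> = sqrt (real (n k)) *
          (nu_hat q \<phi>0 (\<sigma> k) (\<gamma> k) (n k) (\<lambda>i. y k i \<omega>) (t_hat k \<omega>) / l k powr q - 1)" for k \<omega>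
  \<comment> \<open>The linearized error. It is written out instead of using \<open>G\<close>, whose
    properties hold only for the late rows, because \<open>Y k\<close> has to be measurable for
    every \<open>k\<close>.\<close>
  define Y where "Y k \<omega> = - 1 / (c0 powr q * m0) * ((\<Sum>i<n k. cos (c0 * Z k i \<omega>) - m k c0) / sqrt (n k))" for k \<omega>
  let ?v = "v_q q \<phi>0 c0 \<rho>bar"
  have m0: "m0 \<noteq> 0" using c0_zero by (simp add: m0_def)
  have \<alpha>: "0 < \<alpha>" "\<alpha> \<le> 1" using q by (auto simp: \<alpha>_def)
  have \<rho>_eq: "\<rho> k = \<sigma> k / L k" for k by (simp add: \<rho>_def L_def l_def)
  have \<phi>0_cont: "isCont \<phi>0 t" for t
    unfolding \<phi>0_def by (intro isCont_Re F0.isCont_char)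
  have \<phi>0_meas[measurable]: "\<phi>0 \<in> borel_measurable borel"
    unfolding \<phi>0_def by measurable

  \<comment> \<open>Normalization by the scale of the inner product\<close>
  have sum_pos: "0 < (\<Sum>j<p k. \<bar>x k j\<bar> powr q)" for k
    using x_nz[of k] by (auto intro!: sum_pos2)
  have l_pos: "0 < l k" for k
    using sum_pos[of k] by (simp add: l_def lq_norm_def)
  have L_pos: "0 < L k" for k using l_pos \<gamma>_pos by (simp add: L_def)
  have "l k powr q = (\<Sum>j<p k. \<bar>x k j\<bar> powr q)" for k
    unfolding l_def lq_norm_def powr_powr using q sum_pos[of k] by simp
  then have L_powr: "(\<Sum>j<p k. \<bar>\<gamma> k * x k j\<bar> powr q) = L k powr q" for k
    using \<gamma>_pos[of k] l_pos[of k] by (simp add: L_def abs_mult powr_mult sum_distrib_left)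

  \<comment> \<open>Limit of the noise-to-signal ratio and the common constants\<close>
  have n_real: "filterlim (\<lambda>k. real (n k)) at_top sequentially"
    by (rule filterlim_compose[OF filterlim_real_sequentially n_inf])
  have n_ge: "eventually (\<lambda>k. 1 \<le> n k) sequentially"
    using n_inf by (simp add: filterlim_at_top)
  have \<rho>_lim: "(\<lambda>k. \<sigma> k / L k) \<longlonglongrightarrow> \<rho>bar"
  proof -
    have "(\<lambda>k. \<sigma> k / L k - \<rho>bar) \<longlonglongrightarrow> 0"
    proof (rule Lim_null_comparison)
      show "eventually (\<lambda>k. norm (\<sigma> k / L k - \<rho>bar) \<le> \<bar>sqrt (n k) * (\<rho> k - \<rho>bar)\<bar>) sequentially"
        using n_ge
      proof eventually_elim
        case (elim k)
        then have "1 * \<bar>\<rho> k - \<rho>bar\<bar> \<le> sqrt (n k) * \<bar>\<rho> k - \<rho>bar\<bar>"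
          by (intro mult_right_mono) auto
        then show ?case by (simp add: abs_mult \<rho>_eq)
      qed
      show "(\<lambda>k. \<bar>sqrt (n k) * (\<rho> k - \<rho>bar)\<bar>) \<longlonglongrightarrow> 0"
        using A3 by (rule tendsto_rabs_zero)
    qed
    then show ?thesis by (simp add: LIM_zero_iff)
  qed
  \<comment> \<open>The bound \<open>\<rho>bar + 1\<close> serves as \<open>R\<close> for all late
    rows and fixes \<open>K\<close>.\<close>
  have "eventually (\<lambda>k. \<sigma> k / L k < \<rho>bar + 1) sequentially"
    by (rule order_tendstoD[OF \<rho>_lim]) simp
  then have sample: "eventually (\<lambda>k. cosine_sample (M k) (n k) (Z k) (m k) K \<alpha>) sequentially"
    using n_ge
  proof eventually_elim
    case (elim k)
    have "cosine_sample (M k) (n k) (\<lambda>i \<omega>. ((\<Sum>j<p k. a k i j \<omega> * x k j) + \<sigma> k * \<epsilon> k i \<omega>) / L k)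
      (\<lambda>t. exp (- (\<bar>t\<bar> powr q)) * Re (char F0 (\<sigma> k / L k * t)))
      (2 + (\<rho>bar + 1) * (\<integral>e. \<bar>e\<bar> \<partial>F0)) (min q 1)"
      using elim L_powr[of k]
      by (intro cosine_sample_linear_model[OF M_prob q(1) _ L_pos \<sigma>_pos _ F0_distr F0_int indep a_law \<epsilon>_law]) auto
    then show ?case
      by (simp add: Z_def[abs_def] m_def[abs_def] y_def K_def \<alpha>_def \<phi>0_def)
  qed

  \<comment> \<open>Limits of the cosine moments\<close>
  have m_unif: "\<exists>\<delta>>0. eventually (\<lambda>k. \<forall>s. \<bar>s - c0\<bar> < \<delta> \<longrightarrow> \<bar>m k s - m0\<bar> \<le> d) sequentially" if d: "0 < d" for d
  proof -
    \<comment> \<open>Joint continuity in frequency and noise ratio gives closeness uniformly in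
      \<open>s\<close> for all late \<open>k\<close>.\<close>
    let ?h = "\<lambda>z. exp (- (\<bar>fst z\<bar> powr q)) * \<phi>0 (snd z * fst z)"
    have "isCont ?h (c0, \<rho>bar)"
      using c0_pos by (intro continuous_intros isCont_o2[OF _ \<phi>0_cont]) auto
    then have "\<exists>r>0. \<forall>z. dist z (c0, \<rho>bar) < r \<longrightarrow> dist (?h z) (?h (c0, \<rho>bar)) < d"
      using d unfolding continuous_at_eps_delta by simp
    then obtain r where r: "0 < r" "\<And>z. dist z (c0, \<rho>bar) < r \<Longrightarrow> dist (?h z) (?h (c0, \<rho>bar)) < d"
      by blast
    have "eventually (\<lambda>k. dist (\<sigma> k / L k) \<rho>bar < r / 2) sequentially"
      using r(1) by (intro tendstoD[OF \<rho>_lim]) simp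
    then have "eventually (\<lambda>k. \<forall>s. \<bar>s - c0\<bar> < r / 2 \<longrightarrow> \<bar>m k s - m0\<bar> \<le> d) sequentially"
    proof eventually_elim
      case (elim k)
      show ?case
      proof (intro allI impI)
        fix s assume s: "\<bar>s - c0\<bar> < r / 2"
        have "dist (s, \<sigma> k / L k) (c0, \<rho>bar) \<le> \<bar>s - c0\<bar> + dist (\<sigma> k / L k) \<rho>bar"
          unfolding dist_Pair_Pair dist_real_def by (rule sqrt_sum_squares_le_sum_abs[THEN order_trans]) simp
        also have "\<dots> < r" using s elim by linarith
        finally have "dist (?h (s, \<sigma> k / L k)) (?h (c0, \<rho>bar)) < d" by (rule r(2))
        then show "\<bar>m k s - m0\<bar> \<le> d"
          using c0_pos by (simp add: m_def m0_def dist_real_def)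
      qed
    qed
    then show ?thesis using r(1) by (intro exI[of _ "r / 2"]) simp
  qed
  have m_lim: "(\<lambda>k. m k c0) \<longlonglongrightarrow> m0" "(\<lambda>k. m k (2 * c0)) \<longlonglongrightarrow> m2"
  proof -
    have \<phi>0_lim: "(\<lambda>k. \<phi>0 (\<sigma> k / L k * c)) \<longlonglongrightarrow> \<phi>0 (\<rho>bar * c)" for c
      by (intro isCont_tendsto_compose[OF \<phi>0_cont] tendsto_mult \<rho>_lim tendsto_const)
    have "(\<lambda>k. m k c0) \<longlonglongrightarrow> exp (- (\<bar>c0\<bar> powr q)) * \<phi>0 (\<rho>bar * c0)"
      unfolding m_def by (intro tendsto_mult tendsto_const \<phi>0_lim)
    then show "(\<lambda>k. m k c0) \<longlonglongrightarrow> m0" using c0_pos by (simp add: m0_def)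
    have "(\<lambda>k. m k (2 * c0)) \<longlonglongrightarrow> exp (- (\<bar>2 * c0\<bar> powr q)) * \<phi>0 (\<rho>bar * (2 * c0))"
      unfolding m_def by (intro tendsto_mult tendsto_const \<phi>0_lim)
    moreover have "\<rho>bar * (2 * c0) = 2 * (\<rho>bar * c0)" by simp
    ultimately show "(\<lambda>k. m k (2 * c0)) \<longlonglongrightarrow> m2"
      using c0_pos by (simp only: m2_def) simp
  qed

  \<comment> \<open>The numerator is the limiting variance of \<open>G\<close> at \<open>c0\<close>;
    the denominator comes from the slope \<open>- 1 / (c0^q m0)\<close> of the linearized
    error.\<close>
  have v: "0 < ?v" "?v = ((1 + m2) / 2 - m0\<^sup>2) / (c0 powr q * m0)\<^sup>2"
    using v_q_pos[where \<phi> = \<phi>0, OF q c0_pos c0_zero] F0.abs_Re_char_le_1 F0.Re_char_double[of "\<rho>bar * c0"]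
    unfolding m2_def m0_def by (auto simp: \<phi>0_def)

  \<comment> \<open>Measurability of the statistics\<close>
  have y_meas[measurable]: "y k i \<in> borel_measurable (M k)" for k i
  proof -
    note a_rv[measurable] \<epsilon>_rv[measurable]
    have "y k i = (\<lambda>\<omega>. (\<Sum>j<p k. a k i j \<omega> * x k j) + \<sigma> k * \<epsilon> k i \<omega>)" by (simp add: y_def fun_eq_iff)
    then show ?thesis by simp
  qed
  have t_meas[measurable]: "t_hat k \<in> borel_measurable (M k)" for k
  proof -
    have eq: "t_hat k = (\<lambda>\<omega>. T k (restrict (\<lambda>i. y k i \<omega>) {..<n k}))" by (simp add: t_hat_def fun_eq_iff)
    have "(\<lambda>\<omega>. restrict (\<lambda>i. y k i \<omega>) {..<n k}) \<in> M k \<rightarrow>\<^sub>M PiM {..<n k} (\<lambda>_. borel)"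
      by (intro measurable_restrict y_meas)
    then show ?thesis unfolding eq by (rule measurable_compose[OF _ T_meas])
  qed
  have S_meas: "S k \<in> borel_measurable (M k)" for k unfolding S_def by measurable
  have Y_meas: "Y k \<in> borel_measurable (M k)" for k unfolding Y_def Z_def by measurable
  have D_meas: "D k \<in> borel_measurable (M k)" for k
    unfolding D_def nu_hat_def Log_plus_def Re_Psi_hat_div by measurable

  have Y_eq: "Y k \<omega> = - 1 / (c0 powr q * m0) * cosine_sample.G (n k) (Z k) (m k) c0 \<omega>"
    if "cosine_sample (M k) (n k) (Z k) (m k) K \<alpha>" for k \<omega>
    unfolding Y_def cosine_sample.G_def[OF that] cosine_sample.X_def[OF that] ..

  have "weak_conv_m (\<lambda>k. distr (M k) borel (D k)) (normal_law ?v)"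
  proof (rule weak_conv_normal_law_perturbed[OF v(1) M_prob D_meas Y_meas])
    fix u
    let ?c = "- 1 / (c0 powr q * m0)"
    have "(\<lambda>k. char (distr (M k) borel (cosine_sample.G (n k) (Z k) (m k) c0)) (u * ?c))
        \<longlonglongrightarrow> complex_of_real (exp (- (u * ?c)\<^sup>2 * ((1 + m2) / 2 - m0\<^sup>2) / 2))"
      by (rule char_G_tendsto[OF sample n_inf m_lim])
    also have "- (u * ?c)\<^sup>2 * ((1 + m2) / 2 - m0\<^sup>2) / 2 = - u\<^sup>2 * ?v / 2"
      unfolding v(2) by (simp add: power_mult_distrib power_divide)
    finally show "(\<lambda>k. char (distr (M k) borel (Y k)) u) \<longlonglongrightarrow> complex_of_real (exp (- u\<^sup>2 * ?v / 2))"
    proof (rule Lim_transform_eventually)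
      show "eventually (\<lambda>k. char (distr (M k) borel (cosine_sample.G (n k) (Z k) (m k) c0)) (u * ?c)
          = char (distr (M k) borel (Y k)) u) sequentially"
        using sample
      proof eventually_elim
        case (elim k)
        have "Y k = (\<lambda>\<omega>. ?c * cosine_sample.G (n k) (Z k) (m k) c0 \<omega>)"
          by (rule ext) (rule Y_eq[OF elim])
        then show ?case using char_scale[OF cosine_sample.G_measurable[OF elim], of ?c c0 u] by simp
      qed
    qed
  next
    fix e :: real assume e: "0 < e"
    have cons: "(\<lambda>k. measure (M k) {\<omega> \<in> space (M k). \<bar>S k \<omega> - c0\<bar> > d}) \<longlonglongrightarrow> 0" if "0 < d" for d
      using t_hat_cons[OF that] by (simp add: S_def L_def l_def mult.assoc)
    have "eventually (\<lambda>k. \<exists>E\<in>sets (M k). measure (M k) E \<le> e \<and> (\<forall>\<omega>\<in>space (M k) - E.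
      S k \<omega> \<noteq> 0 \<and> m k (S k \<omega>) \<noteq> 0 \<and>
      0 < 1 + cosine_sample.G (n k) (Z k) (m k) (S k \<omega>) \<omega> / (sqrt (n k) * m k (S k \<omega>)) \<and>
      \<bar>- (sqrt (n k) * ln (1 + cosine_sample.G (n k) (Z k) (m k) (S k \<omega>) \<omega> / (sqrt (n k) * m k (S k \<omega>)))
          / \<bar>S k \<omega>\<bar> powr q)
        - (- cosine_sample.G (n k) (Z k) (m k) c0 \<omega> / (c0 powr q * m0))\<bar> \<le> e)) sequentially"
      by (rule log_ratio_linearization[OF sample n_inf \<alpha> c0_pos m0 m_unif S_meas cons e])
    with sample show "eventually (\<lambda>k. \<exists>E\<in>sets (M k). measure (M k) E \<le> e \<and>
        (\<forall>\<omega>\<in>space (M k) - E. \<bar>D k \<omega> - Y k \<omega>\<bar> \<le> e)) sequentially"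
    proof eventually_elim
      case (elim k)
      interpret cosine_sample "M k" "n k" "Z k" "m k" K \<alpha> by (rule elim(1))
      have "\<bar>D k \<omega> - Y k \<omega>\<bar> \<le> e"
        if s: "S k \<omega> \<noteq> 0" "m k (S k \<omega>) \<noteq> 0" "0 < 1 + G (S k \<omega>) \<omega> / (sqrt (n k) * m k (S k \<omega>))"
          "\<bar>- (sqrt (n k) * ln (1 + G (S k \<omega>) \<omega> / (sqrt (n k) * m k (S k \<omega>))) / \<bar>S k \<omega>\<bar> powr q)
            - (- G c0 \<omega> / (c0 powr q * m0))\<bar> \<le> e" for \<omega>
      proof -
        let ?t = "t_hat k \<omega>"
        \<comment> \<open>The scale \<open>L\<close> cancels between the frequency and the
          observations, so the process at \<open>S\<close> sees exactly the cosines and the noise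
          factor used by the estimator at \<open>?t\<close>.\<close>
        have \<sigma>t: "\<sigma> k / L k * S k \<omega> = \<sigma> k * ?t" using L_pos[of k] by (simp add: S_def)
        have SZ: "S k \<omega> * Z k i \<omega> = ?t * y k i \<omega>" for i using L_pos[of k] by (simp add: S_def Z_def)
        have t0: "?t \<noteq> 0" using s(1) by (auto simp: S_def)
        have f0: "\<phi>0 (\<sigma> k * ?t) \<noteq> 0" using s(2) unfolding m_def \<sigma>t by simp
        have St: "?t * (\<gamma> k * l k) = S k \<omega>" by (simp add: S_def L_def)
        have mS: "exp (- (\<bar>S k \<omega>\<bar> powr q)) * \<phi>0 (\<sigma> k * ?t) = m k (S k \<omega>)" by (simp only: m_def \<sigma>t)
        let ?r = "(\<Sum>i<n k. cos (?t * y k i \<omega>)) / n k / m k (S k \<omega>)"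
        have r: "1 + G (S k \<omega>) \<omega> / (sqrt (n k) * m k (S k \<omega>)) = ?r"
          using one_plus_G[OF s(2), of \<omega>] by (simp only: SZ)
        have "D k \<omega> = sqrt (n k) * (- (ln ?r / \<bar>S k \<omega>\<bar> powr q))"
          using nu_hat_eq[where \<gamma> = "\<gamma> k" and l = "l k" and t = ?t and \<phi> = \<phi>0 and \<sigma> = "\<sigma> k" and n = "n k"
              and y = "\<lambda>i. y k i \<omega>" and q = q, unfolded St mS, OF \<gamma>_pos l_pos t0 f0] s(3)
          unfolding D_def r by simp
        then show ?thesis using s(4) Y_eq[OF elim(1), of \<omega>] unfolding r by simp
      qed
      then show ?case using elim(2) by blast
    qed
  qed
  then show ?thesis using v(1) unfolding D_def l_def by blast
qed

end
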